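(* Let $n\geq 1$ be an integer. Then the sequence of unstable modules $$J(n+2)\oplus \mathscr{J}(n+2)\xrightarrow{\left(\begin{smallmatrix}\bullet Sq^{1}&0\\ \bullet Sq^{\frac{n+2}{2}}&0\end{smallmatrix}\right)}J(n+1)\oplus \mathscr{J}(n+1)\xrightarrow{\left(\begin{smallmatrix}\bullet Sq^{1}&0\\ \bullet Sq^{\frac{n+1}{2}}&0\end{smallmatrix}\right)}J(n)\oplus \mathscr{J}(n)$$ is exact (at the middle term), where $\mathscr{J}(n)=J(2k)$ if $n+1=4k$ for some integer $k$, and $\mathscr{J}(n)=0$ otherwise.
   Context: Let $\mathcal{A}_2$ be the mod $2$ Steenrod algebra and $\mathcal{U}$ the category of unstable $\mathcal{A}_2$-modules, i.e. $\mathbb{N}$-graded $\mathcal{A}_2$-modules $M$ with $Sq^{k}x=0$ for all $x\in M^{n}$ and $k>n$. For $n\geq 0$ the Brown–Gitler module $J(n)$ is the (injective) unstable module representing $M\mapsto (M^{n})^{\sharp}=\mathrm{Hom}_{\mathbb{F}_2}(M^{n},\mathbb{F}_2)$, i.e. $\mathrm{Hom}_{\mathcal{U}}(M,J(n))\cong (M^{n})^{\sharp}$ naturally in $M$. For a Steenrod operation $\theta$ of degree $n-m$, $\bullet\theta:J(n)\to J(m)$ denotes the morphism inducing on represented functors the map $(M^{n})^{\sharp}\to (M^{m})^{\sharp}$, $\varphi\mapsto \varphi\circ\theta$. Matrices act on column vectors, the first row giving the component in the first summand of the target. The convention is $Sq^{r/2}=Sq^{j}$ if $r=2j$ is even and $Sq^{r/2}=0$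 if $r$ is odd; the entry $\bullet Sq^{(n+2)/2}:J(n+2)\to\mathscr{J}(n+1)$ (resp. $\bullet Sq^{(n+1)/2}:J(n+1)\to\mathscr{J}(n)$) is zero whenever the target $\mathscr{J}(n+1)$ (resp. $\mathscr{J}(n)$) is zero. *)

theory Defs
  imports
    "HOL-Algebra.Algebra"
    "HOL-Library.Poly_Mapping"
    "HOL-Library.Z2"
    "HOL-Library.FuncSet"
begin

section \<open>The mod 2 Steenrod algebra\<close>

text \<open>Words in the letters \<open>Sq\<^sup>0, Sq\<^sup>1, Sq\<^sup>2, \<dots>\<close>; the monoid is written additively because
  that is what the convolution product of \<^type>\<open>poly_mapping\<close> expects.\<close>

datatype sq_word = Word (letters: "nat list")

instantiation sq_word :: monoid_add
begin

definition "0 = Word []"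
definition "v + w = Word (letters v @ letters w)"

instance
  by standard (simp_all add: zero_sq_word_def plus_sq_word_def)

end

type_synonym free_sq = "sq_word \<Rightarrow>\<^sub>0 bit"

definition gen :: "nat \<Rightarrow> free_sq" where
  "gen i = Poly_Mapping.single (Word [i]) 1"

definition free_algebra :: "free_sq ring" where
  "free_algebra = \<lparr>carrier = UNIV, monoid.mult = (*), one = 1, ring.zero = 0, ring.add = (+)\<rparr>"

definition adem :: "nat \<Rightarrow> nat \<Rightarrow> free_sq" where
  "adem i j = gen i * gen j
     - (\<Sum>c = 0..i div 2. of_nat ((j - c - 1) choose (i - 2 * c)) * (gen (i + j - c) * gen c))"

definition steenrod_ideal :: "free_sq set" where
  "steenrod_ideal = Idl\<^bsub>free_algebra\<^esub> ({gen 0 - 1} \<union> {adem i j |i j. 0 < i \<and> i < 2 * j})"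

definition steenrod :: "free_sq set ring" (\<open>\<A>\<close>) where
  "\<A> = free_algebra Quot steenrod_ideal"

definition steenrod_class :: "free_sq \<Rightarrow> free_sq set" where
  "steenrod_class f = steenrod_ideal +>\<^bsub>free_algebra\<^esub> f"

definition Sq :: "nat \<Rightarrow> free_sq set" where
  "Sq i = steenrod_class (gen i)"

definition steenrod_deg :: "nat \<Rightarrow> free_sq set set" where
  "steenrod_deg d = steenrod_class ` {f. \<forall>w \<in> Poly_Mapping.keys f. sum_list (letters w) = d}"

text \<open>\<open>Sq_half r\<close> is \<open>Sq\<^bsup>r/2\<^esup>\<close>.\<close>

definition Sq_half :: "nat \<Rightarrow> free_sq set" where
  "Sq_half r = (if even r then Sq (r div 2) else \<zero>\<^bsub>\<A>\<^esub>)"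


section \<open>Unstable modules\<close>

text \<open>The component \<open>gr M n\<close> is an abelian group in the multiplicative notation of HOL-Algebra;
  \<open>act M d n \<theta>\<close> is the action of a \<open>\<theta>\<close> of degree \<open>d\<close> on the component of degree \<open>n\<close>.
  No separate vector space structure is needed: the degree 0 part of the Steenrod algebra contains
  \<open>\<bbbF>\<^sub>2\<close>, so the module axioms make each component a vector space over \<open>\<bbbF>\<^sub>2\<close>, whose linear maps
  are the additive ones.\<close>

record 'a gmodule =
  gr :: "nat \<Rightarrow> 'a monoid"
  act :: "nat \<Rightarrow> nat \<Rightarrow> free_sq set \<Rightarrow> 'a \<Rightarrow> 'a"

definition steenrod_module :: "'a gmodule \<Rightarrow> bool" where
  "steenrod_module M \<longleftrightarrow>
     (\<forall>n. comm_group (gr M n)) \<and>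
     (\<forall>d n. \<forall>\<theta> \<in> steenrod_deg d. act M d n \<theta> \<in> hom (gr M n) (gr M (n + d))) \<and>
     (\<forall>d n. \<forall>\<theta> \<in> steenrod_deg d. \<forall>\<eta> \<in> steenrod_deg d. \<forall>x \<in> carrier (gr M n).
        act M d n (\<theta> \<oplus>\<^bsub>\<A>\<^esub> \<eta>) x = act M d n \<theta> x \<otimes>\<^bsub>gr M (n + d)\<^esub> act M d n \<eta> x) \<and>
     (\<forall>d e n. \<forall>\<theta> \<in> steenrod_deg d. \<forall>\<eta> \<in> steenrod_deg e. \<forall>x \<in> carrier (gr M n).
        act M (d + e) n (\<theta> \<otimes>\<^bsub>\<A>\<^esub> \<eta>) x = act M d (n + e) \<theta> (act M e n \<eta> x)) \<and>
     (\<forall>n. \<forall>x \<in> carrier (gr M n). act M 0 n \<one>\<^bsub>\<A>\<^esub> x = x)"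

definition unstable :: "'a gmodule \<Rightarrow> bool" where
  "unstable M \<longleftrightarrow> steenrod_module M \<and>
     (\<forall>n k. \<forall>x \<in> carrier (gr M n). n < k \<longrightarrow> act M k n (Sq k) x = \<one>\<^bsub>gr M (n + k)\<^esub>)"

text \<open>Morphisms and functionals are made extensional, so that equality of functions is equality
  of morphisms.\<close>

definition Mor :: "'a gmodule \<Rightarrow> 'b gmodule \<Rightarrow> (nat \<Rightarrow> 'a \<Rightarrow> 'b) set" where
  "Mor M N = {f.
     (\<forall>n. f n \<in> hom (gr M n) (gr N n) \<inter> extensional (carrier (gr M n))) \<and>
     (\<forall>d n. \<forall>\<theta> \<in> steenrod_deg d. \<forall>x \<in> carrier (gr M n).
        f (n + d) (act M d n \<theta> x) = act N d n \<theta> (f n x))}"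

definition comp_mor ::
    "'a gmodule \<Rightarrow> (nat \<Rightarrow> 'b \<Rightarrow> 'c) \<Rightarrow> (nat \<Rightarrow> 'a \<Rightarrow> 'b) \<Rightarrow> nat \<Rightarrow> 'a \<Rightarrow> 'c" where
  "comp_mor M g f = (\<lambda>n. compose (carrier (gr M n)) (g n) (f n))"

definition zero_mor :: "'a gmodule \<Rightarrow> 'b gmodule \<Rightarrow> nat \<Rightarrow> 'a \<Rightarrow> 'b" where
  "zero_mor M N = (\<lambda>n. \<lambda>x \<in> carrier (gr M n). \<one>\<^bsub>gr N n\<^esub>)"

definition zero_module :: "'a gmodule" where
  "zero_module = \<lparr>gr = (\<lambda>n. singleton_group undefined), act = (\<lambda>d n \<theta> x. undefined)\<rparr>"

definition dsum :: "'a gmodule \<Rightarrow> 'b gmodule \<Rightarrow> ('a \<times> 'b) gmodule" where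
  "dsum M N = \<lparr>gr = (\<lambda>n. gr M n \<times>\<times> gr N n),
               act = (\<lambda>d n \<theta> (x, y). (act M d n \<theta> x, act N d n \<theta> y))\<rparr>"

text \<open>\<open>matrix_mor M M' N N' a b c e\<close> is the map from \<open>M \<oplus> M'\<close> to \<open>N \<oplus> N'\<close> with
  first row \<open>a b\<close> and second row \<open>c e\<close>, acting on column vectors.\<close>

definition matrix_mor ::
    "'a gmodule \<Rightarrow> 'b gmodule \<Rightarrow> 'c gmodule \<Rightarrow> 'd gmodule \<Rightarrow>
     (nat \<Rightarrow> 'a \<Rightarrow> 'c) \<Rightarrow> (nat \<Rightarrow> 'b \<Rightarrow> 'c) \<Rightarrow> (nat \<Rightarrow> 'a \<Rightarrow> 'd) \<Rightarrow> (nat \<Rightarrow> 'b \<Rightarrow> 'd) \<Rightarrow>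
     nat \<Rightarrow> 'a \<times> 'b \<Rightarrow> 'c \<times> 'd" where
  "matrix_mor M M' N N' a b c e =
     (\<lambda>n. \<lambda>(x, y) \<in> carrier (gr (dsum M M') n).
        (a n x \<otimes>\<^bsub>gr N n\<^esub> b n y, c n x \<otimes>\<^bsub>gr N' n\<^esub> e n y))"

definition exact_at ::
    "'a gmodule \<Rightarrow> 'a gmodule \<Rightarrow> 'a gmodule \<Rightarrow> (nat \<Rightarrow> 'a \<Rightarrow> 'a) \<Rightarrow> (nat \<Rightarrow> 'a \<Rightarrow> 'a) \<Rightarrow> bool" where
  "exact_at L M N f g \<longleftrightarrow>
     unstable L \<and> unstable M \<and> unstable N \<and> f \<in> Mor L M \<and> g \<in> Mor M N \<and>
     (\<forall>n. exact_seq ([gr N n, gr M n, gr L n], [g n, f n]))"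


section \<open>Brown-Gitler modules\<close>

definition F2 :: "bit monoid" where
  "F2 = \<lparr>carrier = UNIV, monoid.mult = (+), one = 0\<rparr>"

definition dual :: "'a monoid \<Rightarrow> ('a \<Rightarrow> bit) set" where
  "dual V = hom V F2 \<inter> extensional (carrier V)"

text \<open>\<open>represents n J \<rho>\<close>: the unstable module \<open>J\<close> represents the functor sending \<open>M\<close> to the dual of
  its degree \<open>n\<close> component, through the natural bijections \<open>\<rho> M\<close>. (By the Yoneda lemma these are
  automatically additive.) In HOL the test modules \<open>M\<close> have their components in one fixed type; as soon
  as that type is infinite, it has room for a copy of every unstable module with finite components,
  in particular of the free unstable modules on one generator and of the Brown-Gitler modules.\<close>

definition represents ::
    "nat \<Rightarrow> 'j gmodule \<Rightarrow> ('m gmodule \<Rightarrow> (nat \<Rightarrow> 'm \<Rightarrow> 'j) \<Rightarrow> 'm \<Rightarrow> bit) \<Rightarrow> bool" where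
  "represents n J \<rho> \<longleftrightarrow> unstable J \<and>
     (\<forall>M. unstable M \<longrightarrow> bij_betw (\<rho> M) (Mor M J) (dual (gr M n))) \<and>
     (\<forall>M N. unstable M \<longrightarrow> unstable N \<longrightarrow> (\<forall>h \<in> Mor M N. \<forall>f \<in> Mor N J.
        \<rho> M (comp_mor M f h) = compose (carrier (gr M n)) (\<rho> N f) (h n)))"

text \<open>In what follows \<open>J n\<close>, with \<open>\<rho> n\<close>, represents the functor for \<open>n\<close>.
  For \<open>\<theta>\<close> of degree \<open>n - m\<close>, \<open>bullet J \<rho> n m \<theta>\<close> is the morphism from \<open>J n\<close> to \<open>J m\<close>
  inducing precomposition with \<open>\<theta>\<close> on the represented functors.\<close>

definition bullet ::
    "(nat \<Rightarrow> 'a gmodule) \<Rightarrow> (nat \<Rightarrow> 'a gmodule \<Rightarrow> (nat \<Rightarrow> 'a \<Rightarrow> 'a) \<Rightarrow> 'a \<Rightarrow> bit) \<Rightarrow>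
     nat \<Rightarrow> nat \<Rightarrow> free_sq set \<Rightarrow> nat \<Rightarrow> 'a \<Rightarrow> 'a" where
  "bullet J \<rho> n m \<theta> = (THE f. f \<in> Mor (J n) (J m) \<and>
     (\<forall>M. unstable M \<longrightarrow> (\<forall>h \<in> Mor M (J n).
        \<rho> m M (comp_mor M f h) = compose (carrier (gr M m)) (\<rho> n M h) (act M (n - m) m \<theta>))))"

definition scriptJ :: "(nat \<Rightarrow> 'a gmodule) \<Rightarrow> nat \<Rightarrow> 'a gmodule" where
  "scriptJ J n = (if \<exists>k. n + 1 = 4 * k then J (2 * (THE k. n + 1 = 4 * k)) else zero_module)"

text \<open>The entry \<open>\<bullet>Sq\<^bsup>(n+1)/2\<^esup>\<close>, from \<open>J (n + 1)\<close> to \<open>scriptJ J n\<close>.\<close>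

definition bullet_half ::
    "(nat \<Rightarrow> 'a gmodule) \<Rightarrow> (nat \<Rightarrow> 'a gmodule \<Rightarrow> (nat \<Rightarrow> 'a \<Rightarrow> 'a) \<Rightarrow> 'a \<Rightarrow> bit) \<Rightarrow>
     nat \<Rightarrow> nat \<Rightarrow> 'a \<Rightarrow> 'a" where
  "bullet_half J \<rho> n =
     (if \<exists>k. n + 1 = 4 * k
      then bullet J \<rho> (n + 1) (2 * (THE k. n + 1 = 4 * k)) (Sq_half (n + 1))
      else zero_mor (J (n + 1)) (scriptJ J n))"

text \<open>\<open>bg_map J \<rho> n\<close> is the matrix map with source \<open>bg_sum J (n + 1)\<close> and target \<open>bg_sum J n\<close>.\<close>

definition bg_sum :: "(nat \<Rightarrow> 'a gmodule) \<Rightarrow> nat \<Rightarrow> ('a \<times> 'a) gmodule" where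
  "bg_sum J n = dsum (J n) (scriptJ J n)"

definition bg_map ::
    "(nat \<Rightarrow> 'a gmodule) \<Rightarrow> (nat \<Rightarrow> 'a gmodule \<Rightarrow> (nat \<Rightarrow> 'a \<Rightarrow> 'a) \<Rightarrow> 'a \<Rightarrow> bit) \<Rightarrow>
     nat \<Rightarrow> nat \<Rightarrow> 'a \<times> 'a \<Rightarrow> 'a \<times> 'a" where
  "bg_map J \<rho> n = matrix_mor (J (n + 1)) (scriptJ J (n + 1)) (J n) (scriptJ J n)
     (bullet J \<rho> (n + 1) n (Sq 1)) (zero_mor (scriptJ J (n + 1)) (J n))
     (bullet_half J \<rho> n) (zero_mor (scriptJ J (n + 1)) (scriptJ J n))"


section \<open>Existence of Brown-Gitler modules\<close>

text \<open>The assumption \<^const>\<open>represents\<close> is satisfiable, whatever the type of the test modules. The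
  degree \<open>m\<close> component of \<open>bg_module n\<close> is the dual of the degree \<open>n\<close> component of the free unstable
  module on a generator of degree \<open>m\<close>, i.e. it consists of the functionals on the degree \<open>n - m\<close> part
  of the Steenrod algebra that vanish on the products \<open>\<theta> Sq\<^sup>k \<eta>\<close> with \<open>k > m + e\<close>, \<open>e\<close> the degree
  of \<open>\<eta>\<close>.\<close>

lemma free_algebra_ring: "ring free_algebra"
proof (rule ringI)
  show "abelian_group free_algebra"
  proof (rule abelian_groupI)
    fix x assume "x \<in> carrier free_algebra"
    show "\<exists>y\<in>carrier free_algebra. y \<oplus>\<^bsub>free_algebra\<^esub> x = \<zero>\<^bsub>free_algebra\<^esub>"
      by (rule bexI[of _ "- x"]) (auto simp: free_algebra_def)
  qed (auto simp: free_algebra_def algebra_simps)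
  show "Group.monoid free_algebra"
    by (rule monoidI) (auto simp: free_algebra_def algebra_simps)
qed (auto simp: free_algebra_def algebra_simps)

lemma steenrod_ideal_ideal: "ideal steenrod_ideal free_algebra"
  unfolding steenrod_ideal_def by (rule ring.genideal_ideal[OF free_algebra_ring]) (auto simp: free_algebra_def)

lemma steenrod_ring: "ring \<A>"
  unfolding steenrod_def by (rule ideal.quotient_is_ring[OF steenrod_ideal_ideal])

lemma steenrod_class_hom: "steenrod_class \<in> ring_hom free_algebra \<A>"
  unfolding steenrod_def steenrod_class_def[abs_def] by (rule ideal.rcos_ring_hom[OF steenrod_ideal_ideal])

lemma steenrod_class_add: "steenrod_class f \<oplus>\<^bsub>\<A>\<^esub> steenrod_class g = steenrod_class (f + g)"
  using ring_hom_add[OF steenrod_class_hom, of f g] by (simp add: free_algebra_def)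
lemma steenrod_class_mult: "steenrod_class f \<otimes>\<^bsub>\<A>\<^esub> steenrod_class g = steenrod_class (f * g)"
  using ring_hom_mult[OF steenrod_class_hom, of f g] by (simp add: free_algebra_def)
lemma steenrod_one: "\<one>\<^bsub>\<A>\<^esub> = steenrod_class 1"
  using ring_hom_one[OF steenrod_class_hom] by (simp add: free_algebra_def)
lemma steenrod_zero: "\<zero>\<^bsub>\<A>\<^esub> = steenrod_class 0"
  using ring_hom_zero[OF steenrod_class_hom free_algebra_ring steenrod_ring] by (simp add: free_algebra_def)
lemma steenrod_class_closed: "steenrod_class f \<in> carrier \<A>"
  using ring_hom_closed[OF steenrod_class_hom, of f] by (simp add: free_algebra_def)

lemma steenrod_deg_closed: "\<theta> \<in> steenrod_deg d \<Longrightarrow> \<theta> \<in> carrier \<A>"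
  by (auto simp: steenrod_deg_def steenrod_class_closed)
lemma steenrod_deg_zero: "\<zero>\<^bsub>\<A>\<^esub> \<in> steenrod_deg d"
  by (auto simp: steenrod_deg_def steenrod_zero)
lemma steenrod_deg_one: "\<one>\<^bsub>\<A>\<^esub> \<in> steenrod_deg 0"
  by (auto simp: steenrod_deg_def steenrod_one zero_sq_word_def intro!: imageI)
lemma steenrod_deg_Sq: "Sq i \<in> steenrod_deg i"
  by (auto simp: steenrod_deg_def Sq_def gen_def intro!: imageI)
lemma steenrod_deg_add: assumes "\<theta> \<in> steenrod_deg d" "\<eta> \<in> steenrod_deg d" shows "\<theta> \<oplus>\<^bsub>\<A>\<^esub> \<eta> \<in> steenrod_deg d"
proof -
  obtain f g where fg: "\<theta> = steenrod_class f" "\<eta> = steenrod_class g"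
    "\<forall>w \<in> Poly_Mapping.keys f. sum_list (letters w) = d" "\<forall>w \<in> Poly_Mapping.keys g. sum_list (letters w) = d"
    using assms unfolding steenrod_deg_def by blast
  then have "\<forall>w \<in> Poly_Mapping.keys (f + g). sum_list (letters w) = d"
    using keys_add[of f g] by blast
  then show ?thesis unfolding fg steenrod_class_add steenrod_deg_def by blast
qed
lemma steenrod_deg_mult: assumes "\<theta> \<in> steenrod_deg d" "\<eta> \<in> steenrod_deg e" shows "\<theta> \<otimes>\<^bsub>\<A>\<^esub> \<eta> \<in> steenrod_deg (d + e)"
proof -
  obtain f g where fg: "\<theta> = steenrod_class f" "\<eta> = steenrod_class g"
    "\<forall>w \<in> Poly_Mapping.keys f. sum_list (letters w) = d" "\<forall>w \<in> Poly_Mapping.keys g. sum_list (letters w) = e"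
    using assms unfolding steenrod_deg_def by blast
  have "\<forall>w \<in> Poly_Mapping.keys (f * g). sum_list (letters w) = d + e"
  proof
    fix w assume "w \<in> Poly_Mapping.keys (f * g)"
    then obtain u v where "w = u + v" "u \<in> Poly_Mapping.keys f" "v \<in> Poly_Mapping.keys g"
      using keys_mult[of f g] by blast
    then show "sum_list (letters w) = d + e" using fg by (simp add: plus_sq_word_def)
  qed
  then show ?thesis unfolding fg steenrod_class_mult steenrod_deg_def by blast
qed

interpretation steenrod: ring \<A> by (rule steenrod_ring)

definition bg_dom :: "nat \<Rightarrow> nat \<Rightarrow> free_sq set set" where
  "bg_dom n m = (if m \<le> n then steenrod_deg (n - m) else {\<zero>\<^bsub>\<A>\<^esub>})"

lemma bg_dom_add: "\<theta> \<in> bg_dom n m \<Longrightarrow> \<eta> \<in> bg_dom n m \<Longrightarrow> \<theta> \<oplus>\<^bsub>\<A>\<^esub> \<eta> \<in> bg_dom n m"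
  by (auto simp: bg_dom_def steenrod_deg_add)
lemma bg_dom_zero: "\<zero>\<^bsub>\<A>\<^esub> \<in> bg_dom n m" by (auto simp: bg_dom_def steenrod_deg_zero)

definition bg_carrier :: "nat \<Rightarrow> nat \<Rightarrow> (free_sq set \<Rightarrow> bit) set" where
  "bg_carrier n m = {\<phi> \<in> extensional (bg_dom n m).
    (\<forall>\<theta>\<in>bg_dom n m. \<forall>\<eta>\<in>bg_dom n m. \<phi> (\<theta> \<oplus>\<^bsub>\<A>\<^esub> \<eta>) = \<phi> \<theta> + \<phi> \<eta>) \<and>
    (\<forall>c k e. k > m + e \<longrightarrow> c + k + e + m = n \<longrightarrow> (\<forall>\<theta>\<in>steenrod_deg c. \<forall>\<eta>\<in>steenrod_deg e. \<phi> (\<theta> \<otimes>\<^bsub>\<A>\<^esub> Sq k \<otimes>\<^bsub>\<A>\<^esub> \<eta>) = 0))}"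

definition bg_module :: "nat \<Rightarrow> (free_sq set \<Rightarrow> bit) gmodule" where
  "bg_module n = \<lparr>gr = (\<lambda>m. \<lparr>carrier = bg_carrier n m, monoid.mult = (\<lambda>\<phi> \<psi>. \<lambda>\<theta>\<in>bg_dom n m. \<phi> \<theta> + \<psi> \<theta>), one = (\<lambda>\<theta>\<in>bg_dom n m. 0)\<rparr>),
     act = (\<lambda>d m \<eta> \<phi>. \<lambda>\<theta>\<in>bg_dom n (m + d). if m + d \<le> n then \<phi> (\<theta> \<otimes>\<^bsub>\<A>\<^esub> \<eta>) else 0)\<rparr>"

lemma bg_dom_triple: "c + k + e + m = n \<Longrightarrow> \<theta>\<in>steenrod_deg c \<Longrightarrow> \<eta>\<in>steenrod_deg e \<Longrightarrow> \<theta> \<otimes>\<^bsub>\<A>\<^esub> Sq k \<otimes>\<^bsub>\<A>\<^esub> \<eta> \<in> bg_dom n m"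
  using steenrod_deg_mult[OF steenrod_deg_mult[OF _ steenrod_deg_Sq], of \<theta> c \<eta> e k] by (auto simp: bg_dom_def)

lemma bg_dom_mult: "\<theta> \<in> bg_dom n (m + d) \<Longrightarrow> \<eta> \<in> steenrod_deg d \<Longrightarrow> m + d \<le> n \<Longrightarrow> \<theta> \<otimes>\<^bsub>\<A>\<^esub> \<eta> \<in> bg_dom n m"
  using steenrod_deg_mult[of \<theta> "n - (m + d)" \<eta> d] by (auto simp: bg_dom_def)

lemma bg_dom_carr: "\<theta> \<in> bg_dom n m \<Longrightarrow> \<theta> \<in> carrier \<A>"
  by (auto simp: bg_dom_def steenrod_deg_closed split: if_splits)

lemma bit_add_self: "(a::bit) + a = 0" by (cases a) auto

lemma bg_module_group: "comm_group (gr (bg_module n) m)"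
proof (rule comm_groupI)
  fix x y assume "x \<in> carrier (gr (bg_module n) m)" "y \<in> carrier (gr (bg_module n) m)"
  then have x: "x \<in> bg_carrier n m" and y: "y \<in> bg_carrier n m" by (simp_all add: bg_module_def)
  have bq: "a + b + (c + d) = a + c + (b + d)" for a b c d :: bit by (cases a; cases b; cases c; cases d) simp_all
  have "(\<lambda>\<theta>\<in>bg_dom n m. x \<theta> + y \<theta>) \<in> bg_carrier n m"
    unfolding bg_carrier_def
  proof (intro CollectI conjI ballI allI impI)
    fix \<theta> \<eta> assume "\<theta> \<in> bg_dom n m" "\<eta> \<in> bg_dom n m"
    moreover from this have "x (\<theta> \<oplus>\<^bsub>\<A>\<^esub> \<eta>) = x \<theta> + x \<eta>" "y (\<theta> \<oplus>\<^bsub>\<A>\<^esub> \<eta>) = y \<theta> + y \<eta>"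
      using x y unfolding bg_carrier_def by blast+
    ultimately show "(\<lambda>\<theta>\<in>bg_dom n m. x \<theta> + y \<theta>) (\<theta> \<oplus>\<^bsub>\<A>\<^esub> \<eta>) = (\<lambda>\<theta>\<in>bg_dom n m. x \<theta> + y \<theta>) \<theta> + (\<lambda>\<theta>\<in>bg_dom n m. x \<theta> + y \<theta>) \<eta>"
      by (simp only: restrict_apply' bg_dom_add bq)
  next
    fix c k e \<theta> \<eta> assume a: "k > m + e" "c + k + e + m = n" "\<theta> \<in> steenrod_deg c" "\<eta> \<in> steenrod_deg e"
    then have "x (\<theta> \<otimes>\<^bsub>\<A>\<^esub> Sq k \<otimes>\<^bsub>\<A>\<^esub> \<eta>) = 0" "y (\<theta> \<otimes>\<^bsub>\<A>\<^esub> Sq k \<otimes>\<^bsub>\<A>\<^esub> \<eta>) = 0"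
      using x y unfolding bg_carrier_def by blast+
    then show "(\<lambda>\<theta>\<in>bg_dom n m. x \<theta> + y \<theta>) (\<theta> \<otimes>\<^bsub>\<A>\<^esub> Sq k \<otimes>\<^bsub>\<A>\<^esub> \<eta>) = 0"
      using bg_dom_triple[OF a(2-4)] by simp
  qed simp
  then show "x \<otimes>\<^bsub>gr (bg_module n) m\<^esub> y \<in> carrier (gr (bg_module n) m)"
    by (simp add: bg_module_def)
next
  show "\<one>\<^bsub>gr (bg_module n) m\<^esub> \<in> carrier (gr (bg_module n) m)" by (simp add: bg_module_def bg_carrier_def bg_dom_triple bg_dom_add)
next
  fix x assume "x \<in> carrier (gr (bg_module n) m)"
  then show "\<one>\<^bsub>gr (bg_module n) m\<^esub> \<otimes>\<^bsub>gr (bg_module n) m\<^esub> x = x"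
    by (auto simp: bg_module_def bg_carrier_def intro!: extensionalityI[of _ "bg_dom n m"])
  show "\<exists>y\<in>carrier (gr (bg_module n) m). y \<otimes>\<^bsub>gr (bg_module n) m\<^esub> x = \<one>\<^bsub>gr (bg_module n) m\<^esub>"
    using \<open>x \<in> _\<close> by (intro bexI[of _ x]) (auto simp: bg_module_def bit_add_self)
qed (simp add: bg_module_def restrict_def fun_eq_iff; metis (no_types) bit_not_one_iff zero_neq_one)+

lemma bg_module_act: "\<eta> \<in> steenrod_deg d \<Longrightarrow> act (bg_module n) d m \<eta> \<in> hom (gr (bg_module n) m) (gr (bg_module n) (m + d))"
proof -
  assume h: "\<eta> \<in> steenrod_deg d"
  have "act (bg_module n) d m \<eta> \<phi> \<in> bg_carrier n (m + d)" if "\<phi> \<in> bg_carrier n m" for \<phi>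
  proof (cases "m + d \<le> n")
    case True
    have "\<phi> (\<theta> \<otimes>\<^bsub>\<A>\<^esub> Sq k \<otimes>\<^bsub>\<A>\<^esub> \<eta>' \<otimes>\<^bsub>\<A>\<^esub> \<eta>) = 0"
      if "k > m + d + e" "c + k + e + (m + d) = n" "\<theta> \<in> steenrod_deg c" "\<eta>' \<in> steenrod_deg e" for \<theta> \<eta>' c k e
    proof -
      have "\<phi> (\<theta> \<otimes>\<^bsub>\<A>\<^esub> Sq k \<otimes>\<^bsub>\<A>\<^esub> (\<eta>' \<otimes>\<^bsub>\<A>\<^esub> \<eta>)) = 0"
        using \<open>\<phi> \<in> bg_carrier n m\<close> that steenrod_deg_mult[OF that(4) h] unfolding bg_carrier_def
        by (smt (verit) add.assoc add.commute mem_Collect_eq)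
      then show ?thesis using that h by (simp add: steenrod.m_assoc steenrod_deg_closed steenrod_deg_Sq[THEN steenrod_deg_closed])
    qed
    then show ?thesis using True that h
      by (auto simp: bg_module_def bg_carrier_def bg_dom_triple bg_dom_add steenrod.l_distr bg_dom_carr steenrod_deg_closed bg_dom_mult)
  next
    case False
    then show ?thesis by (auto simp: bg_module_def bg_carrier_def bg_dom_add bg_dom_triple)
  qed
  then show ?thesis using h
    by (auto simp: hom_def bg_module_def restrict_def bg_dom_mult fun_eq_iff)
qed

lemma bg_carrier_zero: "\<phi> \<in> bg_carrier n m \<Longrightarrow> \<phi> \<zero>\<^bsub>\<A>\<^esub> = 0"
proof -
  assume "\<phi> \<in> bg_carrier n m"
  then have "\<phi> (\<zero>\<^bsub>\<A>\<^esub> \<oplus>\<^bsub>\<A>\<^esub> \<zero>\<^bsub>\<A>\<^esub>) = \<phi> \<zero>\<^bsub>\<A>\<^esub> + \<phi> \<zero>\<^bsub>\<A>\<^esub>" using bg_dom_zero unfolding bg_carrier_def by blast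
  then show ?thesis by (simp add: bit_add_self)
qed

lemma bg_module_unstable: "unstable (bg_module n)"
  unfolding unstable_def steenrod_module_def
proof (intro conjI allI ballI impI)
  fix d m \<theta> \<eta> \<phi> assume "\<theta> \<in> steenrod_deg d" "\<eta> \<in> steenrod_deg d" "\<phi> \<in> carrier (gr (bg_module n) m)"
  then show "act (bg_module n) d m (\<theta> \<oplus>\<^bsub>\<A>\<^esub> \<eta>) \<phi> = act (bg_module n) d m \<theta> \<phi> \<otimes>\<^bsub>gr (bg_module n) (m + d)\<^esub> act (bg_module n) d m \<eta> \<phi>"
    by (auto simp: bg_module_def bg_carrier_def bg_dom_mult steenrod.r_distr bg_dom_carr steenrod_deg_closed restrict_def fun_eq_iff)
next
  fix d e m \<theta> \<eta> \<phi> assume *: "\<theta> \<in> steenrod_deg d" "\<eta> \<in> steenrod_deg e" "\<phi> \<in> carrier (gr (bg_module n) m)"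
  have "\<theta>' \<otimes>\<^bsub>\<A>\<^esub> \<theta> \<in> bg_dom n (m + e)" if "\<theta>' \<in> bg_dom n (m + (d + e))" "m + (d + e) \<le> n" for \<theta>'
    using bg_dom_mult[of \<theta>' n "m + e" d \<theta>] that * by (simp add: ac_simps)
  with * show "act (bg_module n) (d + e) m (\<theta> \<otimes>\<^bsub>\<A>\<^esub> \<eta>) \<phi> = act (bg_module n) d (m + e) \<theta> (act (bg_module n) e m \<eta> \<phi>)"
    by (auto simp: bg_module_def steenrod.m_assoc bg_dom_carr steenrod_deg_closed restrict_def fun_eq_iff ac_simps)
next
  fix m \<phi> assume "\<phi> \<in> carrier (gr (bg_module n) m)"
  then have p: "\<phi> \<in> bg_carrier n m" by (simp add: bg_module_def)
  have "act (bg_module n) 0 m \<one>\<^bsub>\<A>\<^esub> \<phi> \<theta> = \<phi> \<theta>" if "\<theta> \<in> bg_dom n m" for \<theta>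
    using that bg_carrier_zero[OF p] by (cases "m \<le> n") (auto simp: bg_module_def bg_dom_carr, auto simp: bg_dom_def)
  then show "act (bg_module n) 0 m \<one>\<^bsub>\<A>\<^esub> \<phi> = \<phi>"
    by (intro extensionalityI[of _ "bg_dom n m"]) (use p in \<open>simp_all add: bg_module_def bg_carrier_def\<close>)
next
  fix m k \<phi> assume *: "\<phi> \<in> carrier (gr (bg_module n) m)" "m < k"
  have "\<phi> (\<theta> \<otimes>\<^bsub>\<A>\<^esub> Sq k) = 0" if "\<theta> \<in> bg_dom n (m + k)" "m + k \<le> n" for \<theta>
  proof -
    have "\<theta> \<in> steenrod_deg (n - (m + k))" "k > m + 0" "n - (m + k) + k + 0 + m = n"
      using that * by (auto simp: bg_dom_def)
    moreover have "\<phi> \<in> bg_carrier n m" using * by (simp add: bg_module_def)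
    ultimately have "\<phi> (\<theta> \<otimes>\<^bsub>\<A>\<^esub> Sq k \<otimes>\<^bsub>\<A>\<^esub> \<one>\<^bsub>\<A>\<^esub>) = 0" using steenrod_deg_one unfolding bg_carrier_def by blast
    then show ?thesis using that by (simp add: bg_dom_carr steenrod_deg_Sq[THEN steenrod_deg_closed])
  qed
  then show "act (bg_module n) k m (Sq k) \<phi> = \<one>\<^bsub>gr (bg_module n) (m + k)\<^esub>"
    by (auto simp: bg_module_def restrict_def fun_eq_iff)
qed (auto intro: bg_module_group bg_module_act)

definition bg_rep :: "nat \<Rightarrow> 'm gmodule \<Rightarrow> (nat \<Rightarrow> 'm \<Rightarrow> free_sq set \<Rightarrow> bit) \<Rightarrow> 'm \<Rightarrow> bit" where
  "bg_rep n M f = (\<lambda>x\<in>carrier (gr M n). f n x \<one>\<^bsub>\<A>\<^esub>)"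

definition bg_rep_inv :: "nat \<Rightarrow> 'm gmodule \<Rightarrow> ('m \<Rightarrow> bit) \<Rightarrow> (nat \<Rightarrow> 'm \<Rightarrow> free_sq set \<Rightarrow> bit)" where
  "bg_rep_inv n M \<psi> = (\<lambda>m. \<lambda>x\<in>carrier (gr M m). \<lambda>\<theta>\<in>bg_dom n m. if m \<le> n then \<psi> (act M (n - m) m \<theta> x) else 0)"

lemma bg_dom_one: "\<one>\<^bsub>\<A>\<^esub> \<in> bg_dom n n" by (simp add: bg_dom_def steenrod_deg_one)

lemma bg_module_represents: "represents n (bg_module n) (bg_rep n)"
  unfolding represents_def
proof (intro conjI allI impI ballI)
  fix M :: "'m gmodule" assume M: "unstable M"
  then have Mc: "\<And>n. comm_group (gr M n)"
    and Mh: "\<And>d n \<theta>. \<theta> \<in> steenrod_deg d \<Longrightarrow> act M d n \<theta> \<in> hom (gr M n) (gr M (n + d))"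
    and Ma: "\<And>d n \<theta> \<eta> x. \<theta> \<in> steenrod_deg d \<Longrightarrow> \<eta> \<in> steenrod_deg d \<Longrightarrow> x \<in> carrier (gr M n) \<Longrightarrow>
        act M d n (\<theta> \<oplus>\<^bsub>\<A>\<^esub> \<eta>) x = act M d n \<theta> x \<otimes>\<^bsub>gr M (n + d)\<^esub> act M d n \<eta> x"
    and Mm: "\<And>d e n \<theta> \<eta> x. \<theta> \<in> steenrod_deg d \<Longrightarrow> \<eta> \<in> steenrod_deg e \<Longrightarrow> x \<in> carrier (gr M n) \<Longrightarrow>
        act M (d + e) n (\<theta> \<otimes>\<^bsub>\<A>\<^esub> \<eta>) x = act M d (n + e) \<theta> (act M e n \<eta> x)"
    and M1: "\<And>n x. x \<in> carrier (gr M n) \<Longrightarrow> act M 0 n \<one>\<^bsub>\<A>\<^esub> x = x"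
    and Mu: "\<And>n k x. x \<in> carrier (gr M n) \<Longrightarrow> n < k \<Longrightarrow> act M k n (Sq k) x = \<one>\<^bsub>gr M (n + k)\<^esub>"
    unfolding unstable_def steenrod_module_def by blast+
  have Mcl: "act M d n \<theta> x \<in> carrier (gr M (n + d))" if "\<theta> \<in> steenrod_deg d" "x \<in> carrier (gr M n)" for d n \<theta> x
    using Mh[OF that(1)] that(2) by (auto simp: hom_def)
  show "bij_betw (bg_rep n M) (Mor M (bg_module n)) (dual (gr M n))"
  proof (rule bij_betw_byWitness[of _ "bg_rep_inv n M"])
    show "bg_rep n M ` Mor M (bg_module n) \<subseteq> dual (gr M n)"
    proof
      fix y assume "y \<in> bg_rep n M ` Mor M (bg_module n)"
      then obtain f where f: "f \<in> Mor M (bg_module n)" and y: "y = bg_rep n M f" by blast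
      have "f n \<in> hom (gr M n) (gr (bg_module n) n)" using f by (auto simp: Mor_def)
      then have "f n (a \<otimes>\<^bsub>gr M n\<^esub> b) \<one>\<^bsub>\<A>\<^esub> = f n a \<one>\<^bsub>\<A>\<^esub> + f n b \<one>\<^bsub>\<A>\<^esub>"
        if "a \<in> carrier (gr M n)" "b \<in> carrier (gr M n)" for a b
        using that bg_dom_one by (auto simp: hom_def bg_module_def)
      moreover have "a \<otimes>\<^bsub>gr M n\<^esub> b \<in> carrier (gr M n)" if "a \<in> carrier (gr M n)" "b \<in> carrier (gr M n)" for a b
        using that Mc[of n] by (simp add: comm_group_def group_def monoid.m_closed)
      ultimately show "y \<in> dual (gr M n)"
        by (auto simp: y dual_def hom_def F2_def bg_rep_def)
    qed
  next
    show "\<forall>f\<in>Mor M (bg_module n). bg_rep_inv n M (bg_rep n M f) = f"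
    proof
      fix f assume f: "f \<in> Mor M (bg_module n)"
      show "bg_rep_inv n M (bg_rep n M f) = f"
      proof
        fix m
        have ext: "f m \<in> extensional (carrier (gr M m))" using f by (auto simp: Mor_def)
        have cl: "f m x \<in> bg_carrier n m" if "x \<in> carrier (gr M m)" for x
          using f that by (auto simp: Mor_def hom_def bg_module_def)
        show "bg_rep_inv n M (bg_rep n M f) m = f m"
        proof (rule extensionalityI[OF _ ext])
          show "bg_rep_inv n M (bg_rep n M f) m \<in> extensional (carrier (gr M m))" by (simp add: bg_rep_inv_def)
          fix x assume x: "x \<in> carrier (gr M m)"
          show "bg_rep_inv n M (bg_rep n M f) m x = f m x"
          proof (rule extensionalityI[of _ "bg_dom n m"])
            show "f m x \<in> extensional (bg_dom n m)" using cl[OF x] by (simp add: bg_carrier_def)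
            show "bg_rep_inv n M (bg_rep n M f) m x \<in> extensional (bg_dom n m)" using x by (simp add: bg_rep_inv_def)
            fix \<theta> assume t: "\<theta> \<in> bg_dom n m"
            show "bg_rep_inv n M (bg_rep n M f) m x \<theta> = f m x \<theta>"
            proof (cases "m \<le> n")
              case True
              have t': "\<theta> \<in> steenrod_deg (n - m)" using t True by (simp add: bg_dom_def)
              have "f (m + (n - m)) (act M (n - m) m \<theta> x) = act (bg_module n) (n - m) m \<theta> (f m x)"
                using f t' x unfolding Mor_def by blast
              moreover have "act (bg_module n) (n - m) m \<theta> (f m x) \<one>\<^bsub>\<A>\<^esub> = f m x \<theta>"
                using True t bg_dom_one by (simp add: bg_module_def bg_dom_carr)
              ultimately show ?thesis using True x t Mcl[OF t' x] by (simp add: bg_rep_inv_def bg_rep_def)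
            next
              case False
              then show ?thesis using t x bg_carrier_zero[OF cl[OF x]] by (simp add: bg_rep_inv_def bg_dom_def)
            qed
          qed
        qed
      qed
    qed
  next
    show "\<forall>\<psi>\<in>dual (gr M n). bg_rep n M (bg_rep_inv n M \<psi>) = \<psi>"
      by (auto simp: bg_rep_def bg_rep_inv_def dual_def bg_dom_one M1 intro!: extensionalityI[of _ "carrier (gr M n)"])
  next
    show "bg_rep_inv n M ` dual (gr M n) \<subseteq> Mor M (bg_module n)"
    proof
      fix f assume "f \<in> bg_rep_inv n M ` dual (gr M n)"
      then obtain \<psi> where \<psi>: "\<psi> \<in> dual (gr M n)" and f: "f = bg_rep_inv n M \<psi>" by blast
      have add: "\<psi> (a \<otimes>\<^bsub>gr M n\<^esub> b) = \<psi> a + \<psi> b" if "a \<in> carrier (gr M n)" "b \<in> carrier (gr M n)" for a b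
        using \<psi> that by (auto simp: dual_def hom_def F2_def)
      have mon: "Group.monoid (gr M k)" for k using Mc[of k] by (simp add: comm_group_def group_def)
      have one: "\<psi> \<one>\<^bsub>gr M n\<^esub> = 0"
        using add[of "\<one>\<^bsub>gr M n\<^esub>" "\<one>\<^bsub>gr M n\<^esub>"] mon[of n] by (simp add: monoid.one_closed monoid.r_one bit_add_self)
      have grp: "group (gr M k)" for k using Mc[of k] by (simp add: comm_group_def)
      have act1: "act M d k \<theta> \<one>\<^bsub>gr M k\<^esub> = \<one>\<^bsub>gr M (k + d)\<^esub>" if "\<theta> \<in> steenrod_deg d" for d k \<theta>
        using hom_one[OF Mh[OF that] grp grp] .
      have fx: "f m x \<in> bg_carrier n m" if x: "x \<in> carrier (gr M m)" for m x
      proof -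
        have a1: "f m x (\<theta> \<oplus>\<^bsub>\<A>\<^esub> \<eta>) = f m x \<theta> + f m x \<eta>" if "\<theta> \<in> bg_dom n m" "\<eta> \<in> bg_dom n m" for \<theta> \<eta>
        proof (cases "m \<le> n")
          case True
          then have t: "\<theta> \<in> steenrod_deg (n - m)" "\<eta> \<in> steenrod_deg (n - m)" using that by (auto simp: bg_dom_def)
          have n: "m + (n - m) = n" using True by simp
          show ?thesis using that True x bg_dom_add[OF that] add Mcl[OF t(1) x] Mcl[OF t(2) x] Ma[OF t x]
            unfolding n by (simp add: f bg_rep_inv_def)
        next
          case False then show ?thesis using that x bg_dom_add[OF that] by (simp add: f bg_rep_inv_def)
        qed
        have a2: "f m x (\<theta> \<otimes>\<^bsub>\<A>\<^esub> Sq k \<otimes>\<^bsub>\<A>\<^esub> \<eta>) = 0"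
          if "k > m + e" "c + k + e + m = n" "\<theta>\<in>steenrod_deg c" "\<eta>\<in>steenrod_deg e" for \<theta> \<eta> c k e
        proof -
          have n: "n - m = c + k + e" "m \<le> n" "m + e + k + c = n" using that by auto
          have "act M (c + k + e) m (\<theta> \<otimes>\<^bsub>\<A>\<^esub> Sq k \<otimes>\<^bsub>\<A>\<^esub> \<eta>) x
             = act M (c + k) (m + e) (\<theta> \<otimes>\<^bsub>\<A>\<^esub> Sq k) (act M e m \<eta> x)"
            using Mm[OF steenrod_deg_mult[OF that(3) steenrod_deg_Sq] that(4) x] .
          also have "\<dots> = act M c (m + e + k) \<theta> (act M k (m + e) (Sq k) (act M e m \<eta> x))"
            using Mm[OF that(3) steenrod_deg_Sq Mcl[OF that(4) x]] .
          also have "\<dots> = \<one>\<^bsub>gr M n\<^esub>"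
            using Mu[OF Mcl[OF that(4) x] that(1)] act1[OF that(3)] n(3) by simp
          finally show ?thesis using n(2) one bg_dom_triple[OF that(2-4)] x by (simp add: f bg_rep_inv_def n(1))
        qed
        show ?thesis using a1 a2 x by (simp add: bg_carrier_def) (simp add: f bg_rep_inv_def)
      qed
      show "f \<in> Mor M (bg_module n)"
        unfolding Mor_def
      proof (intro CollectI conjI allI ballI IntI)
        fix m
        show "f m \<in> extensional (carrier (gr M m))" by (simp add: f bg_rep_inv_def)
        show "f m \<in> hom (gr M m) (gr (bg_module n) m)"
        proof (rule homI)
          fix x y assume xy: "x \<in> carrier (gr M m)" "y \<in> carrier (gr M m)"
          then have c: "x \<otimes>\<^bsub>gr M m\<^esub> y \<in> carrier (gr M m)" using mon by (simp add: monoid.m_closed)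
          have "\<psi> (act M (n - m) m \<theta> (x \<otimes>\<^bsub>gr M m\<^esub> y)) = \<psi> (act M (n - m) m \<theta> x) + \<psi> (act M (n - m) m \<theta> y)"
            if "\<theta> \<in> bg_dom n m" "m \<le> n" for \<theta>
          proof -
            have t: "\<theta> \<in> steenrod_deg (n - m)" "m + (n - m) = n" using that by (auto simp: bg_dom_def)
            then show ?thesis using Mcl[OF t(1) xy(1)] Mcl[OF t(1) xy(2)] hom_mult[OF Mh[OF t(1)] xy] add by simp
          qed
          then show "f m (x \<otimes>\<^bsub>gr M m\<^esub> y) = f m x \<otimes>\<^bsub>gr (bg_module n) m\<^esub> f m y"
            using xy c by (auto simp: f bg_rep_inv_def bg_module_def restrict_def fun_eq_iff)
        qed (simp add: fx bg_module_def)
      next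
        fix d m \<theta> x assume t: "\<theta> \<in> steenrod_deg d" and x: "x \<in> carrier (gr M m)"
        have "\<psi> (act M (n - (m + d)) (m + d) \<eta> (act M d m \<theta> x)) = \<psi> (act M (n - m) m (\<eta> \<otimes>\<^bsub>\<A>\<^esub> \<theta>) x)"
          if "m + d \<le> n" "\<eta> \<in> bg_dom n (m + d)" for \<eta>
        proof -
          have e: "\<eta> \<in> steenrod_deg (n - (m + d))" "n - m = n - (m + d) + d" using that by (auto simp: bg_dom_def)
          show ?thesis unfolding e(2) using Mm[OF e(1) t x] by simp
        qed
        then show "f (m + d) (act M d m \<theta> x) = act (bg_module n) d m \<theta> (f m x)"
          using Mcl[OF t x] x bg_dom_mult[OF _ t] by (auto simp: f bg_rep_inv_def bg_module_def restrict_def fun_eq_iff)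
      qed
    qed
  qed
next
  fix M N :: "'m gmodule" and h f
  assume "h \<in> Mor M N" "f \<in> Mor N (bg_module n)"
  then show "bg_rep n M (comp_mor M f h) = compose (carrier (gr M n)) (bg_rep n N f) (h n)"
    by (auto simp: bg_rep_def comp_mor_def compose_def Mor_def hom_def restrict_def fun_eq_iff)
qed (rule bg_module_unstable)

end

theory Submission
  imports Defs
begin

text \<open>The degree \<open>m\<close> component of \<open>J(n)\<close> is dual to the degree \<open>n\<close> component of the free unstable
  module \<open>F(m)\<close> on a generator \<open>\<iota>\<close> of degree \<open>m\<close>. Under this duality the two entries of the matrix
  become the transposes of \<open>x \<mapsto> Sq\<^sup>1 x\<close> and of the top square \<open>x \<mapsto> Sq\<^bsup>2k\<^esup> x\<close> on elements of degree
  \<open>2k\<close>. So the theorem says that the homology of \<open>Sq\<^sup>1\<close> on \<open>F(m)\<close> consists of the classes of the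
  top squares of elements of even degree, and that the top square is injective on these elements
  modulo the image of \<open>Sq\<^sup>1\<close>.

  This is visible on the basis \<open>Sq\<^sup>I \<iota>\<close> of \<open>F(m)\<close>, with \<open>I = (i, I')\<close> admissible of excess at most
  \<open>m\<close>. If \<open>i\<close> is odd, \<open>Sq\<^sup>1\<close> kills \<open>Sq\<^sup>I \<iota>\<close>, which is itself \<open>Sq\<^sup>1\<close> of the basis element obtained
  by lowering \<open>i\<close> to \<open>i - 1\<close>. If \<open>i\<close> is even, \<open>Sq\<^sup>1\<close> raises \<open>i\<close> to \<open>i + 1\<close>, and the result is
  again a basis element unless the excess is already \<open>m\<close>; in that case the result vanishes by
  instability, \<open>i\<close> equals the degree of \<open>Sq\<^bsup>I'\<^esup> \<iota>\<close>, and \<open>Sq\<^sup>I \<iota>\<close> is the top square of \<open>Sq\<^bsup>I'\<^esup> \<iota>\<close>.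
  The generator itself behaves like a word with \<open>i = 0\<close>. Dually, a functional that lifts given
  \<open>(\<phi>, \<chi>)\<close> can be written down on the basis: it takes the value \<open>\<phi>(i - 1, I')\<close> when \<open>i\<close> is odd,
  \<open>\<chi>(I')\<close> when \<open>i\<close> is even and the excess is \<open>m\<close>, and 0 otherwise (\<open>bg_exact\<close>).

  That the admissible words span is the usual rewriting with Adem relations
  (\<open>bg_carrier_vanishes\<close>). Their independence is needed in the form that functionals with
  prescribed values exist (\<open>exists_bg_carrier\<close>). The functionals come from the \<open>m\<close>-th tensor power
  of \<open>F(1)\<close>, which has the basis \<open>u, u\<^sup>2, u\<^sup>4, \<dots>\<close> (\<open>exists_functional\<close>). The Adem relations hold
  there by induction on \<open>m\<close>: extended to all integer exponents they pass to a further tensor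
  factor, as a consequence of the Frobenius identity for binomial coefficients mod 2
  (\<open>tsq2_adem\<close>).

  The given modules \<open>J n\<close> are only known through their universal property. By the Yoneda argument
  each is isomorphic to the explicit module of functionals \<^term>\<open>bg_module n\<close> (\<open>represents_realizes\<close>).
  The test modules of this argument have their elements in the type \<open>'a\<close>, which has room for a
  copy of \<^term>\<open>bg_module n\<close>: this type is infinite and the components of \<^term>\<open>bg_module n\<close> are finite.\<close>

\<comment> \<open>Sums of bits are to be treated by the group laws, not as exclusive disjunctions.\<close>
declare add_bit_eq_xor [simp del] mult_bit_eq_and [simp del]

lemma bit_swap4: "(a::bit) + b + (c + d) = a + c + (b + d)"
  by (simp add: ac_simps)

lemma bit_add_self_left [simp]: "(a::bit) + (a + b) = b"
  by (cases a; cases b) auto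

lemma bit_add_eq_0_iff: "(a::bit) + b = 0 \<longleftrightarrow> a = b"
  by (cases a; cases b) auto

section \<open>Binomial coefficients mod 2\<close>

text \<open>The coefficient of \<open>t\<^sup>y\<close> in \<open>(1 + t)\<^sup>x\<close> modulo 2, where \<open>x\<close> may be negative: then it is \<open>\<plusminus>
  (y - x - 1 choose y)\<close>, and the sign does not matter.\<close>

definition binom2 :: "int \<Rightarrow> int \<Rightarrow> bit" where
  "binom2 x y = (if y < 0 then 0
     else if 0 \<le> x then of_nat (nat x choose nat y)
     else of_nat ((nat (- x) + nat y - 1) choose nat y))"

lemma binom2_neg [simp]: "y < 0 \<Longrightarrow> binom2 x y = 0"
  by (simp add: binom2_def)

lemma binom2_Suc: "binom2 (x + 1) y = binom2 x y + binom2 x (y - 1)"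
proof -
  consider "y < 0" | "y = 0" | "0 < y" "0 \<le> x" | "0 < y" "x = -1" | "0 < y" "x < -1" by linarith
  then show ?thesis
  proof cases
    case 1 then show ?thesis by simp
  next
    case 2 then show ?thesis by (simp add: binom2_def)
  next
    case 3
    define a b where "a = nat x" and "b = nat (y - 1)"
    have "x = int a" "y = int b + 1" using 3 by (auto simp: a_def b_def)
    then show ?thesis by (simp add: binom2_def nat_add_distrib add.commute)
  next
    case 4
    define b where "b = nat (y - 1)"
    have "y = int b + 1" using 4 by (auto simp: b_def)
    then show ?thesis using 4 by (simp add: binom2_def nat_add_distrib bit_add_self)
  next
    case 5
    define a b where "a = nat (-x - 2)" and "b = nat (y - 1)"
    have xy: "x = - int a - 2" "y = int b + 1" using 5 by (auto simp: a_def b_def)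
    have n: "nat (2 + int a) = Suc (Suc a)" "nat (1 + int a) = Suc a" "nat (int b + 1) = Suc b" by auto
    have "binom2 (x + 1) y = of_nat (Suc (a + b) choose Suc b)"
      using n by (simp add: xy binom2_def add.commute[of "int a" 1] del: binomial_Suc_Suc)
    moreover have "binom2 x y = of_nat (Suc (Suc (a + b)) choose Suc b)"
      using n by (simp add: xy binom2_def del: binomial_Suc_Suc)
    moreover have "binom2 x (y - 1) = of_nat (Suc (a + b) choose b)"
      using n by (simp add: xy binom2_def del: binomial_Suc_Suc)
    moreover have "(of_nat (Suc (Suc (a + b)) choose Suc b) :: bit)
        = of_nat (Suc (a + b) choose b) + of_nat (Suc (a + b) choose Suc b)"
      by (simp only: binomial_Suc_Suc of_nat_add)
    ultimately show ?thesis
      by (simp only:) (metis add.commute bit_add_self_left)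
  qed
qed

text \<open>In characteristic 2, \<open>(1 + t)\<^sup>q = 1 + t\<^sup>q\<close> for \<open>q\<close> a power of 2.\<close>

lemma binom2_frobenius: "binom2 (x + 2 ^ i) y = binom2 x y + binom2 x (y - 2 ^ i)"
proof (induction i arbitrary: x y)
  case 0 show ?case using binom2_Suc[of x y] by simp
next
  case (Suc i)
  have "binom2 (x + 2 ^ Suc i) y = binom2 (x + 2 ^ i) y + binom2 (x + 2 ^ i) (y - 2 ^ i)"
    using Suc[of "x + 2 ^ i" y] by (simp add: ac_simps)
  also have "\<dots> = binom2 x y + binom2 x (y - 2 ^ i) + (binom2 x (y - 2 ^ i) + binom2 x (y - 2 ^ Suc i))"
    using Suc[of x y] Suc[of x "y - 2 ^ i"] by (simp add: algebra_simps)
  also have "\<dots> = binom2 x y + binom2 x (y - 2 ^ Suc i)"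
    by (simp only: add.assoc bit_add_self_left)
  finally show ?case .
qed

text \<open>Both sides are the coefficient of \<open>t\<^sup>y\<close> in \<open>(1 + t)\<^bsup>x + q\<^esup>\<close>, where \<open>q = 2\<^sup>i\<close>. This is the
  identity by which the Adem relations pass to a tensor product with \<open>F(1)\<close>.\<close>

lemma binom2_shift:
  "binom2 x y + binom2 (x - 2 ^ i) (y - 2 * 2 ^ i) = binom2 x (y - 2 ^ i) + binom2 (x - 2 ^ i) y"
proof -
  have "binom2 x y + binom2 x (y - 2 ^ i) = binom2 (x + 2 ^ i) y"
    by (simp add: binom2_frobenius)
  also have "\<dots> = binom2 (x - 2 ^ i) y + binom2 (x - 2 ^ i) (y - 2 * 2 ^ i)"
    using binom2_frobenius[of "x - 2 ^ i" "Suc i" y] by (simp add: algebra_simps)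
  finally have *: "binom2 x y + binom2 x (y - 2 ^ i)
      = binom2 (x - 2 ^ i) y + binom2 (x - 2 ^ i) (y - 2 * 2 ^ i)" .
  have "a + d = b + c" if "a + b = c + d" for a b c d :: bit
    using that by (cases a; cases b; cases c; cases d) simp_all
  from this[OF *] show ?thesis .
qed

text \<open>Up to sign this is the central binomial coefficient \<open>2a choose a\<close>, which is even.\<close>

lemma binom2_central: "0 < a \<Longrightarrow> binom2 (- a - 1) a = 0"
proof -
  assume "0 < a"
  define b where "b = nat (a - 1)"
  have a: "a = int b + 1" using \<open>0 < a\<close> by (simp add: b_def)
  have n: "nat (int b + 1) = Suc b" "nat (int b + 2) = Suc (Suc b)" by auto
  have "(2 * b + 1 choose b) = (2 * b + 1 choose Suc b)"
    using binomial_symmetric[of b "2 * b + 1"] by simp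
  then have "of_nat (Suc (2 * b + 1) choose Suc b) = (0 :: bit)"
    by (simp only: binomial_Suc_Suc of_nat_add bit_add_self)
  moreover have "Suc (Suc b) + Suc b - 1 = Suc (2 * b + 1)" by simp
  moreover have "- (- a - 1) = int b + 2" using a by simp
  ultimately show ?thesis
    using n by (simp only: binom2_def a) simp
qed

section \<open>Squares on functions on tensor powers of \<open>F(1)\<close>\<close>

text \<open>The list \<open>[i\<^sub>1, \<dots>, i\<^sub>m]\<close> stands for the element \<open>u^(2^i\<^sub>1) \<otimes> \<dots> \<otimes> u^(2^i\<^sub>m)\<close> of the \<open>m\<close>-th
  tensor power of \<open>F(1)\<close>, where the only nonzero squares are \<open>Sq\<^sup>0\<close> and \<open>Sq\<^bsup>q\<^esup> u\<^sup>q = u\<^bsup>2q\<^esup>\<close>. A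
  function \<open>\<phi>\<close> on lists is a linear functional on the tensor powers, and \<open>tsq x k \<phi>\<close> is \<open>\<phi> (Sq\<^sup>k
  x)\<close>, computed by the Cartan formula. Working with functionals avoids formal sums of lists;
  integer exponents, with zero operations in negative degrees, let the Adem relations be shifted
  freely.\<close>

primrec tsq :: "nat list \<Rightarrow> int \<Rightarrow> (nat list \<Rightarrow> bit) \<Rightarrow> bit" where
  "tsq [] k \<phi> = (if k = 0 then \<phi> [] else 0)"
| "tsq (i # x) k \<phi> = tsq x k (\<lambda>y. \<phi> (i # y)) + tsq x (k - 2 ^ i) (\<lambda>y. \<phi> (Suc i # y))"

text \<open>The degree of the tensor that the list stands for.\<close>

definition wt :: "nat list \<Rightarrow> nat" where
  "wt x = (\<Sum>i\<leftarrow>x. 2 ^ i)"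

lemma wt_simps [simp]: "wt [] = 0" "wt (i # x) = 2 ^ i + wt x"
  by (simp_all add: wt_def)

lemma tsq_0 [simp]: "tsq x k (\<lambda>y. 0) = 0"
  by (induction x arbitrary: k) auto

lemma tsq_add: "tsq x k (\<lambda>y. \<phi> y + \<psi> y) = tsq x k \<phi> + tsq x k \<psi>"
  by (induction x arbitrary: k \<phi> \<psi>) (auto simp: bit_swap4)

lemma tsq_cmult: "tsq x k (\<lambda>y. c * \<phi> y) = c * tsq x k \<phi>"
  by (induction x arbitrary: k \<phi>) (auto simp: distrib_left)

lemma tsq_sum: "tsq x k (\<lambda>y. \<Sum>c\<in>C. \<phi> c y) = (\<Sum>c\<in>C. tsq x k (\<phi> c))"
  by (induction C rule: infinite_finite_induct) (auto simp: tsq_add)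

lemma tsq_neg [simp]: "k < 0 \<Longrightarrow> tsq x k \<phi> = 0"
proof (induction x arbitrary: k \<phi>)
  case (Cons i x)
  have "k - 2 ^ i < 0" using Cons.prems by (smt (verit) zero_less_power)
  then show ?case using Cons by simp
qed simp

lemma tsq_id [simp]: "tsq x 0 \<phi> = \<phi> x"
  by (induction x arbitrary: \<phi>) auto

lemma tsq_unstable: "int (wt x) < k \<Longrightarrow> tsq x k \<phi> = 0"
proof (induction x arbitrary: k \<phi>)
  case (Cons i x)
  have "int (wt x) < k" "int (wt x) < k - 2 ^ i"
    using Cons.prems by (simp_all, smt (verit) zero_less_power)
  then show ?case by (simp add: Cons.IH)
qed simp

text \<open>The top square of a tensor of powers of \<open>u\<close> squares each factor.\<close>

lemma tsq_top: "tsq x (int (wt x)) \<phi> = \<phi> (map Suc x)"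
proof (induction x arbitrary: \<phi>)
  case (Cons i x)
  have "tsq x (2 ^ i + int (wt x)) (\<lambda>y. \<phi> (i # y)) = 0"
    by (rule tsq_unstable) simp
  then show ?case using Cons by simp
qed simp

lemma tsq_cong:
  "(\<And>y. length y = length x \<Longrightarrow> int (wt y) = int (wt x) + k \<Longrightarrow> \<phi> y = \<psi> y) \<Longrightarrow> tsq x k \<phi> = tsq x k \<psi>"
proof (induction x arbitrary: k \<phi> \<psi>)
  case (Cons i x)
  have "tsq x k (\<lambda>y. \<phi> (i # y)) = tsq x k (\<lambda>y. \<psi> (i # y))"
    "tsq x (k - 2 ^ i) (\<lambda>y. \<phi> (Suc i # y)) = tsq x (k - 2 ^ i) (\<lambda>y. \<psi> (Suc i # y))"
    by (rule Cons.IH; rule Cons.prems; simp)+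
  then show ?case by simp
qed simp

text \<open>The value of \<open>\<phi>\<close> on \<open>Sq\<^sup>a Sq\<^sup>b x\<close>: transposition reverses the order of composition.\<close>

definition tsq2 :: "nat list \<Rightarrow> int \<Rightarrow> int \<Rightarrow> (nat list \<Rightarrow> bit) \<Rightarrow> bit" where
  "tsq2 x a b \<phi> = tsq x b (\<lambda>y. tsq y a \<phi>)"

lemma tsq2_Cons:
  "tsq2 (i # x) a b \<phi> = tsq2 x a b (\<lambda>y. \<phi> (i # y)) + tsq2 x (a - 2 ^ i) b (\<lambda>y. \<phi> (Suc i # y))
     + (tsq2 x a (b - 2 ^ i) (\<lambda>y. \<phi> (Suc i # y))
     + tsq2 x (a - 2 * 2 ^ i) (b - 2 ^ i) (\<lambda>y. \<phi> (Suc (Suc i) # y)))"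
  by (simp add: tsq2_def tsq_add)

lemma tsq2_neg: "a < 0 \<or> b < 0 \<Longrightarrow> tsq2 x a b \<phi> = 0"
  by (auto simp: tsq2_def)

text \<open>Beyond \<open>a div 2\<close> the binomial coefficient vanishes and below 0 the operation does, so that
  the Adem sum may run over any larger set. This is what makes changes of the summation index
  harmless.\<close>

lemma adem_sum_superset:
  fixes g :: "int \<Rightarrow> int \<Rightarrow> bit"
  assumes "finite C" "{0..a div 2} \<subseteq> C" "\<And>p q. q < 0 \<Longrightarrow> g p q = 0"
  shows "(\<Sum>c\<in>C. binom2 (b - c - 1) (a - 2 * c) * g (a + b - c) c)
    = (\<Sum>c\<in>{0..a div 2}. binom2 (b - c - 1) (a - 2 * c) * g (a + b - c) c)"
proof (rule sum.mono_neutral_right[OF assms(1,2)], rule ballI)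
  fix c assume "c \<in> C - {0..a div 2}"
  then have "c < 0 \<or> a - 2 * c < 0" by auto
  then show "binom2 (b - c - 1) (a - 2 * c) * g (a + b - c) c = 0" using assms(3) by auto
qed

text \<open>The Adem relation for all integers \<open>a\<close>, \<open>b\<close>, without the restriction \<open>a < 2b\<close>. The
  generality is needed for the induction on the number of tensor factors: by the Cartan formula
  for \<open>u\<^sup>q \<otimes> x\<close> the relation for \<open>(a, b)\<close> reduces to those for \<open>(a, b)\<close>, \<open>(a - q, b)\<close>,
  \<open>(a, b - q)\<close> and \<open>(a - 2q, b - q)\<close> on \<open>x\<close>, and these may violate the restriction.\<close>

lemma tsq2_adem:
  "tsq2 x a b \<phi> = (\<Sum>c\<in>{0..a div 2}. binom2 (b - c - 1) (a - 2 * c) * tsq2 x (a + b - c) c \<phi>)"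
proof (induction x arbitrary: a b \<phi>)
  case Nil
  show ?case
  proof (cases "0 \<le> a \<and> a + b = 0")
    case True
    have "(\<Sum>c\<in>{0..a div 2}. binom2 (b - c - 1) (a - 2 * c) * tsq2 [] (a + b - c) c \<phi>)
        = (\<Sum>c\<in>{0}. binom2 (b - c - 1) (a - 2 * c) * tsq2 [] (a + b - c) c \<phi>)"
      using True by (intro sum.mono_neutral_right) (auto simp: tsq2_def)
    also have "\<dots> = binom2 (- a - 1) a * \<phi> []" using True by (simp add: tsq2_def minus_unique)
       (metis add.commute add_eq_0_iff uminus_add_conv_diff)
    also have "\<dots> = tsq2 [] a b \<phi>"
      using True binom2_central[of a] by (cases "a = 0") (auto simp: tsq2_def binom2_def)
    finally show ?thesis by simp
  next
    case False
    then have "(\<Sum>c\<in>{0..a div 2}. binom2 (b - c - 1) (a - 2 * c) * tsq2 [] (a + b - c) c \<phi>) = 0"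
      by (intro sum.neutral) (auto simp: tsq2_def)
    then show ?thesis using False by (auto simp: tsq2_def)
  qed
next
  case (Cons i x)
  define q :: int where "q = 2 ^ i"
  have q: "q > 0" by (simp add: q_def)
  define p0 p1 p2 where "p0 = (\<lambda>y. \<phi> (i # y))" and "p1 = (\<lambda>y. \<phi> (Suc i # y))"
    and "p2 = (\<lambda>y. \<phi> (Suc (Suc i) # y))"
  \<comment> \<open>A range that contains all summation ranges in question; \<open>D\<close> is its translate by \<open>- q\<close>.\<close>
  define C where "C = {- q..\<bar>a\<bar> + q}"
  define D where "D = {- 2 * q..\<bar>a\<bar>}"
  have D: "D = (\<lambda>c. c - q) ` C"
  proof -
    have "c \<in> (\<lambda>c. c - q) ` C" if "c \<in> D" for c
      using that by (intro image_eqI[of _ _ "c + q"]) (auto simp: C_def D_def)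
    then show ?thesis by (auto simp: C_def D_def)
  qed
  have reindex: "(\<Sum>c\<in>C. f c) = (\<Sum>c\<in>D. f (c + q))" for f :: "int \<Rightarrow> bit"
    unfolding D by (subst sum.reindex) (auto simp: inj_on_def)
  have sup: "(\<Sum>c\<in>E. binom2 (b' - c - 1) (a' - 2 * c) * tsq2 x (a' + b' - c) c \<psi>) = tsq2 x a' b' \<psi>"
    if "finite E" "{0..a' div 2} \<subseteq> E" for E a' b' \<psi>
    unfolding Cons.IH[of a' b' \<psi>]
    using that by (rule adem_sum_superset[where g = "\<lambda>p c. tsq2 x p c \<psi>"]) (simp add: tsq2_neg)
  let ?B = "\<lambda>c. binom2 (b - c - 1) (a - 2 * c)"
  \<comment> \<open>The terms are collected by the power of \<open>u\<close> in the first factor: \<open>p0\<close>, \<open>p2\<close> and, twice, \<open>p1\<close>.\<close>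
  have g1: "(\<Sum>c\<in>C. ?B c * tsq2 x (a + b - c) c p0) = tsq2 x a b p0"
    using q by (intro sup) (auto simp: C_def)
  have g4: "(\<Sum>c\<in>C. ?B c * tsq2 x (a + b - c - 2 * q) (c - q) p2) = tsq2 x (a - 2 * q) (b - q) p2"
  proof -
    have "finite D" "{0..(a - 2 * q) div 2} \<subseteq> D" using q by (auto simp: D_def)
    then show ?thesis
      using sup[of D "a - 2 * q" "b - q" p2] unfolding reindex by (simp add: algebra_simps)
  qed
  have "(\<Sum>c\<in>C. ?B c * tsq2 x (a + b - c - q) c p1) + (\<Sum>c\<in>C. ?B c * tsq2 x (a + b - c) (c - q) p1)
      = (\<Sum>c\<in>C \<union> D. ?B c * tsq2 x (a + b - c - q) c p1)
      + (\<Sum>c\<in>C \<union> D. binom2 (b - c - 1 - q) (a - 2 * c - 2 * q) * tsq2 x (a + b - c - q) c p1)"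
  proof (intro arg_cong2[where f = "(+)"])
    show "(\<Sum>c\<in>C. ?B c * tsq2 x (a + b - c - q) c p1) = (\<Sum>c\<in>C \<union> D. ?B c * tsq2 x (a + b - c - q) c p1)"
      using q by (intro sum.mono_neutral_left) (auto simp: C_def D_def tsq2_neg)
    have "(\<Sum>c\<in>C. ?B c * tsq2 x (a + b - c) (c - q) p1)
        = (\<Sum>c\<in>D. binom2 (b - c - 1 - q) (a - 2 * c - 2 * q) * tsq2 x (a + b - c - q) c p1)"
      unfolding reindex by (simp add: algebra_simps)
    also have "\<dots> = (\<Sum>c\<in>C \<union> D. binom2 (b - c - 1 - q) (a - 2 * c - 2 * q) * tsq2 x (a + b - c - q) c p1)"
      using q by (intro sum.mono_neutral_left) (auto simp: C_def D_def)
    finally show "(\<Sum>c\<in>C. ?B c * tsq2 x (a + b - c) (c - q) p1)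
        = (\<Sum>c\<in>C \<union> D. binom2 (b - c - 1 - q) (a - 2 * c - 2 * q) * tsq2 x (a + b - c - q) c p1)" .
  qed
  also have "\<dots> = (\<Sum>c\<in>C \<union> D. binom2 (b - c - 1) (a - 2 * c - q) * tsq2 x (a + b - c - q) c p1)
      + (\<Sum>c\<in>C \<union> D. binom2 (b - c - 1 - q) (a - 2 * c) * tsq2 x (a + b - c - q) c p1)"
    using binom2_shift[of _ _ i, folded q_def] by (simp flip: sum.distrib distrib_right)
  also have "\<dots> = tsq2 x (a - q) b p1 + tsq2 x a (b - q) p1"
  proof (intro arg_cong2[where f = "(+)"])
    have "(\<Sum>c\<in>C \<union> D. binom2 (b - c - 1) (a - q - 2 * c) * tsq2 x (a - q + b - c) c p1) = tsq2 x (a - q) b p1"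
      using q by (intro sup) (auto simp: C_def D_def)
    then show "(\<Sum>c\<in>C \<union> D. binom2 (b - c - 1) (a - 2 * c - q) * tsq2 x (a + b - c - q) c p1) = tsq2 x (a - q) b p1"
      by (simp add: algebra_simps)
    have "(\<Sum>c\<in>C \<union> D. binom2 (b - q - c - 1) (a - 2 * c) * tsq2 x (a + (b - q) - c) c p1) = tsq2 x a (b - q) p1"
      using q by (intro sup) (auto simp: C_def D_def)
    then show "(\<Sum>c\<in>C \<union> D. binom2 (b - c - 1 - q) (a - 2 * c) * tsq2 x (a + b - c - q) c p1) = tsq2 x a (b - q) p1"
      by (simp add: algebra_simps)
  qed
  finally have g23: "(\<Sum>c\<in>C. ?B c * tsq2 x (a + b - c - q) c p1) + (\<Sum>c\<in>C. ?B c * tsq2 x (a + b - c) (c - q) p1)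
      = tsq2 x (a - q) b p1 + tsq2 x a (b - q) p1" .
  have cons: "tsq2 (i # x) a' b' \<phi> = tsq2 x a' b' p0 + tsq2 x (a' - q) b' p1
     + (tsq2 x a' (b' - q) p1 + tsq2 x (a' - 2 * q) (b' - q) p2)" for a' b'
    by (simp add: tsq2_Cons p0_def p1_def p2_def q_def)
  have "(\<Sum>c\<in>{0..a div 2}. ?B c * tsq2 (i # x) (a + b - c) c \<phi>) = (\<Sum>c\<in>C. ?B c * tsq2 (i # x) (a + b - c) c \<phi>)"
    using q by (subst adem_sum_superset[of C a "\<lambda>p c. tsq2 (i # x) p c \<phi>"]) (auto simp: C_def tsq2_neg)
  also have "\<dots> = (\<Sum>c\<in>C. ?B c * tsq2 x (a + b - c) c p0)
      + (\<Sum>c\<in>C. ?B c * tsq2 x (a + b - c - q) c p1)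
      + ((\<Sum>c\<in>C. ?B c * tsq2 x (a + b - c) (c - q) p1)
      + (\<Sum>c\<in>C. ?B c * tsq2 x (a + b - c - 2 * q) (c - q) p2))"
    by (simp add: cons distrib_left sum.distrib)
  also have "\<dots> = tsq2 (i # x) a b \<phi>"
    using g1 g4 g23 by (simp add: cons add.assoc)
  finally show ?case ..
qed

section \<open>From functions on words to functionals on the Steenrod algebra\<close>

definition monom_word :: "nat list \<Rightarrow> free_sq" where
  "monom_word w = Poly_Mapping.single (Word w) 1"

definition lin :: "(nat list \<Rightarrow> bit) \<Rightarrow> free_sq \<Rightarrow> bit" where
  "lin h f = (\<Sum>w\<in>Poly_Mapping.keys f. Poly_Mapping.lookup f w * h (letters w))"

lemma gen_eq_monom_word: "gen i = monom_word [i]"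
  by (simp add: gen_def monom_word_def)

lemma one_eq_monom_word: "1 = monom_word []"
  by (simp add: monom_word_def zero_sq_word_def flip: single_one)

lemma monom_word_mult [simp]: "monom_word u * monom_word v = monom_word (u @ v)"
  by (simp add: monom_word_def mult_single plus_sq_word_def)

lemma keys_monom_word [simp]: "Poly_Mapping.keys (monom_word w) = {Word w}"
  by (simp add: monom_word_def)

lemma update_eq_add_monom_word:
  assumes "a \<notin> Poly_Mapping.keys f" "b \<noteq> 0"
  shows "Poly_Mapping.update a b f = f + monom_word (letters a)"
  using assms by (intro poly_mapping_eqI)
    (auto simp: lookup_update lookup_add monom_word_def lookup_single when_def in_keys_iff)

lemma free_sq_induct [case_names zero word add]:
  assumes "P 0" "\<And>w. P (monom_word w)" "\<And>f g. P f \<Longrightarrow> P g \<Longrightarrow> P (f + g)"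
  shows "P f"
proof (induction f rule: update_induct)
  case const
  then show ?case by (rule assms)
next
  case (update f a b)
  then show ?case using assms update_eq_add_monom_word[of a f b] by simp
qed

lemma lin_superset:
  assumes "finite A" "Poly_Mapping.keys f \<subseteq> A"
  shows "lin h f = (\<Sum>w\<in>A. Poly_Mapping.lookup f w * h (letters w))"
  unfolding lin_def using assms by (intro sum.mono_neutral_left) (auto simp: in_keys_iff)

lemma lin_0 [simp]: "lin h 0 = 0"
  by (simp add: lin_def)

lemma lin_monom_word [simp]: "lin h (monom_word w) = h w"
  by (simp add: lin_def) (simp add: monom_word_def)

lemma lin_add [simp]: "lin h (f + g) = lin h f + lin h g"
proof -
  let ?A = "Poly_Mapping.keys f \<union> Poly_Mapping.keys g"
  have "Poly_Mapping.keys (f + g) \<subseteq> ?A" by (rule keys_add)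
  then show ?thesis
    by (simp add: lin_superset[of ?A] lookup_add distrib_right sum.distrib)
qed

lemma lin_diff: "lin h (f - g) = lin h f + lin h g"
  using lin_add[of h "f - g" g] by (metis add.assoc add.commute bit_add_self_left diff_add_cancel)

lemma lin_of_nat: "lin h (of_nat k * f) = of_nat k * lin h f"
  by (induction k) (simp_all add: distrib_right)

lemma lin_sum: "lin h (\<Sum>c\<in>C. f c) = (\<Sum>c\<in>C. lin h (f c))"
  by (induction C rule: infinite_finite_induct) simp_all

lemma lin_context: "lin h (monom_word u * f * monom_word v) = lin (\<lambda>w. h (u @ w @ v)) f"
  by (induction f rule: free_sq_induct) (simp_all add: distrib_left distrib_right)

lemma free_algebra_simps [simp]:
  "carrier free_algebra = UNIV" "x \<otimes>\<^bsub>free_algebra\<^esub> y = x * y" "\<one>\<^bsub>free_algebra\<^esub> = 1"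
  "x \<oplus>\<^bsub>free_algebra\<^esub> y = x + y" "\<zero>\<^bsub>free_algebra\<^esub> = 0"
  by (simp_all add: free_algebra_def)

text \<open>The condition under which the linear extension of \<open>h\<close> vanishes on the two-sided ideal of
  relations, that is, on all multiples \<open>u R v\<close> of the defining relations \<open>R\<close> by words.\<close>

definition adem_functional :: "(nat list \<Rightarrow> bit) \<Rightarrow> bool" where
  "adem_functional h \<longleftrightarrow> (\<forall>u v. h (u @ 0 # v) = h (u @ v)) \<and>
     (\<forall>u v i j. 0 < i \<longrightarrow> i < 2 * j \<longrightarrow>
        h (u @ i # j # v)
        = (\<Sum>c = 0..i div 2. of_nat ((j - c - 1) choose (i - 2 * c)) * h (u @ (i + j - c) # c # v)))"

lemma lin_adem:
  "lin h (monom_word u * adem i j * monom_word v)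
   = h (u @ i # j # v)
     + (\<Sum>c = 0..i div 2. of_nat ((j - c - 1) choose (i - 2 * c)) * h (u @ (i + j - c) # c # v))"
  by (simp add: lin_context adem_def lin_diff lin_sum lin_of_nat gen_eq_monom_word)

lemma two_sided_ideal:
  assumes "\<And>f g. f \<in> K \<Longrightarrow> g \<in> K \<Longrightarrow> f + g \<in> K" "0 \<in> K" "\<And>f. f \<in> K \<Longrightarrow> - f \<in> K"
    and "\<And>f g. f \<in> K \<Longrightarrow> g * f \<in> K" "\<And>f g. f \<in> K \<Longrightarrow> f * g \<in> K"
  shows "ideal K free_algebra"
proof (rule idealI[OF free_algebra_ring])
  interpret ring free_algebra by (rule free_algebra_ring)
  show "subgroup K (add_monoid free_algebra)"
  proof
    fix f assume f: "f \<in> K"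
    have "inv\<^bsub>add_monoid free_algebra\<^esub> f = - f"
      using group.inv_equality[OF a_group, of "- f" f] by simp
    then show "inv\<^bsub>add_monoid free_algebra\<^esub> f \<in> K" using assms(3) f by simp
  qed (use assms(1,2) in simp_all)
qed (use assms(4,5) in simp_all)

text \<open>The elements all of whose multiples \<open>u f v\<close> by words are annihilated form a two-sided ideal;
  it contains the defining relations, hence the ideal that they generate.\<close>

lemma lin_ideal:
  assumes "adem_functional h" "f \<in> steenrod_ideal"
  shows "lin h f = 0"
proof -
  define K where "K = {f. \<forall>u v. lin h (monom_word u * f * monom_word v) = 0}"
  have "ideal K free_algebra"
  proof (rule two_sided_ideal)
    fix f g assume f: "f \<in> K"
    have "lin h (monom_word u * (g * f) * monom_word v) = 0" for u v
    proof (induction g rule: free_sq_induct)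
      case (word w)
      have "monom_word u * (monom_word w * f) * monom_word v = monom_word (u @ w) * f * monom_word v"
        by (simp add: mult.assoc flip: monom_word_mult)
      then show ?case using f by (simp add: K_def)
    qed (simp_all add: distrib_left distrib_right)
    then show "g * f \<in> K" by (simp add: K_def)
    have "lin h (monom_word u * (f * g) * monom_word v) = 0" for u v
    proof (induction g rule: free_sq_induct)
      case (word w)
      have "monom_word u * (f * monom_word w) * monom_word v = monom_word u * f * monom_word (w @ v)"
        by (simp add: mult.assoc flip: monom_word_mult)
      then show ?case using f by (simp add: K_def)
    qed (simp_all add: distrib_left distrib_right)
    then show "f * g \<in> K" by (simp add: K_def)
  next
    fix f assume "f \<in> K"
    have "lin h (- g) = lin h g" for g using lin_diff[of h 0 g] by simp
    with \<open>f \<in> K\<close> show "- f \<in> K" by (simp add: K_def)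
  qed (simp_all add: K_def distrib_left distrib_right)
  moreover have "{gen 0 - 1} \<union> {adem i j |i j. 0 < i \<and> i < 2 * j} \<subseteq> K"
  proof -
    have "lin h (monom_word u * (gen 0 - 1) * monom_word v) = 0" for u v
      using assms(1) by (simp add: lin_context lin_diff gen_eq_monom_word one_eq_monom_word adem_functional_def bit_add_self)
    moreover have "lin h (monom_word u * adem i j * monom_word v) = 0" if "0 < i" "i < 2 * j" for u v i j
      using assms(1) that unfolding lin_adem adem_functional_def by (auto simp: bit_add_self)
    ultimately show ?thesis by (auto simp: K_def)
  qed
  ultimately have "steenrod_ideal \<subseteq> K"
    unfolding steenrod_ideal_def by (rule ring.genideal_minimal[OF free_algebra_ring])
  then have "f \<in> K" using assms(2) by blast
  then have "lin h (monom_word [] * f * monom_word []) = 0" unfolding K_def by blast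
  then show ?thesis by (simp flip: one_eq_monom_word)
qed

lemma steenrod_class_eq_iff: "steenrod_class f = steenrod_class g \<longleftrightarrow> f - g \<in> steenrod_ideal"
proof -
  interpret I: ideal steenrod_ideal free_algebra by (rule steenrod_ideal_ideal)
  have coset: "steenrod_class f = {k + f | k. k \<in> steenrod_ideal}" for f
    by (auto simp: steenrod_class_def a_r_coset_def r_coset_def)
  show ?thesis
  proof
    assume "steenrod_class f = steenrod_class g"
    moreover have "f \<in> steenrod_class f" 
      using additive_subgroup.zero_closed[OF I.additive_subgroup_axioms] by (force simp: coset)
    ultimately obtain k where "k \<in> steenrod_ideal" "f = k + g" by (auto simp: coset)
    then show "f - g \<in> steenrod_ideal" by simp
  next
    assume *: "f - g \<in> steenrod_ideal"
    have "steenrod_class (f - g) = \<zero>\<^bsub>\<A>\<^esub>"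
      unfolding steenrod_class_def steenrod_def using * I.a_rcos_const by (simp add: FactRing_def)
    then show "steenrod_class f = steenrod_class g"
      using steenrod_class_add[of "f - g" g] steenrod_class_closed[of g] by simp
  qed
qed

text \<open>The functional induced on the Steenrod algebra, which is independent of the representative
  when \<open>h\<close> satisfies the Adem relations.\<close>

definition functional_of :: "(nat list \<Rightarrow> bit) \<Rightarrow> free_sq set \<Rightarrow> bit" where
  "functional_of h \<theta> = lin h (SOME f. steenrod_class f = \<theta>)"

lemma functional_of_class:
  assumes "adem_functional h"
  shows "functional_of h (steenrod_class f) = lin h f"
proof -
  have "steenrod_class (SOME g. steenrod_class g = steenrod_class f) = steenrod_class f"
    by (rule someI) (rule refl)
  from lin_ideal[OF assms, of "(SOME g. steenrod_class g = steenrod_class f) - f"] this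
  show ?thesis by (simp add: functional_of_def lin_diff steenrod_class_eq_iff bit_add_eq_0_iff)
qed

section \<open>Composites of Steenrod squares\<close>

definition Sqs :: "nat list \<Rightarrow> free_sq set" where
  "Sqs w = steenrod_class (monom_word w)"

lemma Sqs_closed [simp]: "Sqs w \<in> carrier \<A>"
  by (simp add: Sqs_def steenrod_class_closed)

lemma Sqs_deg: "Sqs w \<in> steenrod_deg (sum_list w)"
  unfolding Sqs_def steenrod_deg_def by (rule imageI) simp

lemma Sqs_mult: "Sqs u \<otimes>\<^bsub>\<A>\<^esub> Sqs v = Sqs (u @ v)"
  by (simp add: Sqs_def steenrod_class_mult)

lemma Sq_eq: "Sq i = Sqs [i]"
  by (simp add: Sq_def Sqs_def gen_eq_monom_word)

lemma Sqs_Cons: "Sqs (i # w) = Sq i \<otimes>\<^bsub>\<A>\<^esub> Sqs w"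
  by (simp add: Sq_eq Sqs_mult)

definition homogeneous :: "nat \<Rightarrow> free_sq \<Rightarrow> bool" where
  "homogeneous d f \<longleftrightarrow> (\<forall>w \<in> Poly_Mapping.keys f. sum_list (letters w) = d)"

lemma homogeneous_simps [simp]: "homogeneous d 0" "homogeneous d (monom_word w) \<longleftrightarrow> sum_list w = d"
  by (simp_all add: homogeneous_def)

lemma homogeneous_add: "homogeneous d f \<Longrightarrow> homogeneous d g \<Longrightarrow> homogeneous d (f + g)"
  using keys_add[of f g] by (auto simp: homogeneous_def)

lemma homogeneous_diff: "homogeneous d f \<Longrightarrow> homogeneous d g \<Longrightarrow> homogeneous d (f - g)"
  using keys_diff[of f g] by (auto simp: homogeneous_def)

lemma homogeneous_of_nat: "homogeneous d f \<Longrightarrow> homogeneous d (of_nat k * f)"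
  by (induction k) (simp_all add: distrib_right homogeneous_add)

lemma homogeneous_sum: "(\<And>c. c \<in> C \<Longrightarrow> homogeneous d (f c)) \<Longrightarrow> homogeneous d (\<Sum>c\<in>C. f c)"
  by (induction C rule: infinite_finite_induct) (simp_all add: homogeneous_add)

lemma homogeneous_mult: "homogeneous d f \<Longrightarrow> homogeneous e g \<Longrightarrow> homogeneous (d + e) (f * g)"
  using keys_mult[of f g] by (fastforce simp: homogeneous_def plus_sq_word_def)

text \<open>For \<open>i < 2 j\<close> every index \<open>c\<close> of the sum is less than \<open>j\<close>, so the truncated subtraction in
  the definition of \<^const>\<open>adem\<close> is a genuine one.\<close>

lemma homogeneous_adem:
  assumes "0 < i" "i < 2 * j" shows "homogeneous (i + j) (adem i j)"
  unfolding adem_def gen_eq_monom_word monom_word_mult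
  using assms by (intro homogeneous_diff homogeneous_sum homogeneous_of_nat) auto

lemma steenrod_deg_iff: "\<theta> \<in> steenrod_deg d \<longleftrightarrow> (\<exists>f. homogeneous d f \<and> \<theta> = steenrod_class f)"
  by (auto simp: steenrod_deg_def homogeneous_def)

lemma homogeneous_induct [consumes 1, case_names zero add]:
  assumes "homogeneous d f" "P 0"
    and "\<And>f w. homogeneous d f \<Longrightarrow> sum_list w = d \<Longrightarrow> P f \<Longrightarrow> P (f + monom_word w)"
  shows "P f"
  using assms(1)
proof (induction f rule: update_induct)
  case const
  then show ?case by (simp add: assms(2))
next
  case (update f a b)
  have "Poly_Mapping.keys (Poly_Mapping.update a b f) = insert a (Poly_Mapping.keys f)"
    using update by (auto simp: in_keys_iff lookup_update split: if_splits)
  then have "homogeneous d f" "sum_list (letters a) = d"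
    using update.prems by (auto simp: homogeneous_def)
  then show ?case using assms(3) update update_eq_add_monom_word[of a f b] by simp
qed

lemma monom_word_context_ideal:
  assumes "f \<in> steenrod_ideal" shows "monom_word u * f * monom_word v \<in> steenrod_ideal"
  using assms ideal.I_l_closed[OF steenrod_ideal_ideal, of f "monom_word u"]
    ideal.I_r_closed[OF steenrod_ideal_ideal, of "monom_word u * f" "monom_word v"] by simp

lemma steenrod_class_ideal: "f \<in> steenrod_ideal \<Longrightarrow> steenrod_class f = \<zero>\<^bsub>\<A>\<^esub>"
  using steenrod_class_eq_iff[of f 0] by (simp add: steenrod_zero)

lemma relations_in_ideal:
  "gen 0 - 1 \<in> steenrod_ideal" "0 < i \<Longrightarrow> i < 2 * j \<Longrightarrow> adem i j \<in> steenrod_ideal"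
  using ring.genideal_self[OF free_algebra_ring, of "{gen 0 - 1} \<union> {adem i j |i j. 0 < i \<and> i < 2 * j}"]
  unfolding steenrod_ideal_def by auto

lemma adem_context_zero:
  "0 < i \<Longrightarrow> i < 2 * j \<Longrightarrow> steenrod_class (monom_word u * adem i j * monom_word v) = \<zero>\<^bsub>\<A>\<^esub>"
  by (intro steenrod_class_ideal monom_word_context_ideal relations_in_ideal)

lemma Sqs_drop0: "Sqs (u @ 0 # v) = Sqs (u @ v)"
proof -
  have "monom_word u * (gen 0 - 1) * monom_word v = monom_word (u @ 0 # v) - monom_word (u @ v)"
    by (simp add: gen_eq_monom_word one_eq_monom_word right_diff_distrib left_diff_distrib)
  then show ?thesis
    using monom_word_context_ideal[OF relations_in_ideal(1), of u v] by (simp add: Sqs_def steenrod_class_eq_iff)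
qed

text \<open>The Adem relation \<open>Sq\<^sup>1 Sq\<^sup>j = (j - 1) Sq\<^bsup>j + 1\<^esup>\<close>, together with the case \<open>j = 0\<close>, where
  \<open>Sq\<^sup>0\<close> is the identity.\<close>

lemma Sq_1_Sq:
  "Sqs (1 # j # w) = (if even j then Sqs (Suc j # w) else \<zero>\<^bsub>\<A>\<^esub>)"
proof (cases "j = 0")
  case True
  then show ?thesis using Sqs_drop0[of "[1]" w] by simp
next
  case False
  have "steenrod_class (monom_word [] * adem 1 j * monom_word w) = \<zero>\<^bsub>\<A>\<^esub>"
    using False by (intro adem_context_zero) auto
  moreover have "(of_nat (j - 1) :: free_sq) = of_bool (even j)"
  proof -
    have two: "(1::free_sq) + 1 = 0"
      by (intro poly_mapping_eqI) (simp add: lookup_add bit_add_self del: one_add_one)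
    have "(of_nat k :: free_sq) = of_bool (odd k)" for k
      by (induction k) (auto simp: two simp del: one_add_one)
    then show ?thesis using False by simp
  qed
  then have "monom_word [] * adem 1 j * monom_word w = monom_word (1 # j # w) - of_bool (even j) * monom_word (Suc j # [0] @ w)"
    using False by (simp add: adem_def gen_eq_monom_word left_diff_distrib mult.assoc flip: one_eq_monom_word)
  ultimately have "steenrod_class (monom_word (1 # j # w) - of_bool (even j) * monom_word (Suc j # [0] @ w)) = steenrod_class 0"
    by (simp add: steenrod_zero)
  then have "steenrod_class (monom_word (1 # j # w)) = steenrod_class (of_bool (even j) * monom_word (Suc j # [0] @ w))"
    by (simp add: steenrod_class_eq_iff)
  then show ?thesis
    using Sqs_drop0[of "[Suc j]" w] by (auto simp: Sqs_def steenrod_zero)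
qed

section \<open>Admissible words\<close>

fun admissible :: "nat list \<Rightarrow> bool" where
  "admissible [] = True"
| "admissible [i] = (0 < i)"
| "admissible (i # j # w) = (2 * j \<le> i \<and> admissible (j # w))"

text \<open>For an admissible word \<open>i # v\<close> the excess is \<open>i - sum_list v\<close>. If it exceeds \<open>m\<close>, the word
  annihilates classes of degree \<open>m\<close> by instability.\<close>

definition excess_le :: "nat \<Rightarrow> nat list \<Rightarrow> bool" where
  "excess_le m w = (case w of [] \<Rightarrow> True | i # v \<Rightarrow> i \<le> m + sum_list v)"

lemma excess_le_simps [simp]: "excess_le m []" "excess_le m (i # v) \<longleftrightarrow> i \<le> m + sum_list v"
  by (simp_all add: excess_le_def)

lemma admissible_ConsD: "admissible (i # w) \<Longrightarrow> admissible w \<and> 0 < i"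
  by (induction w arbitrary: i) force+

lemma admissible_excess_tl:
  assumes "admissible (i # w)" "excess_le m (i # w)"
  shows "excess_le m w"
  using assms by (cases w) auto

text \<open>The top square of a basis element of positive degree is again a basis element.\<close>

lemma admissible_top_Cons:
  assumes "admissible w" "excess_le m w" "0 < m + sum_list w"
  shows "admissible ((m + sum_list w) # w)"
  using assms by (cases w) auto

text \<open>On a class of degree 0 only the identity survives.\<close>

lemma admissible_excess_0:
  assumes "admissible w" "excess_le 0 w"
  shows "w = []"
  using assms
proof (induction w)
  case (Cons i w)
  have "w = []"
    using Cons.IH admissible_ConsD[OF Cons.prems(1)] admissible_excess_tl[OF Cons.prems] by blast
  then show ?case using Cons.prems by auto
qed simp

section \<open>Functionals with prescribed values on admissible words\<close>

text \<open>The value of \<open>\<phi>\<close> on \<open>Sq\<^sup>w x\<close>.\<close>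

primrec tsq_word :: "nat list \<Rightarrow> (nat list \<Rightarrow> bit) \<Rightarrow> nat list \<Rightarrow> bit" where
  "tsq_word [] \<phi> = \<phi>"
| "tsq_word (i # w) \<phi> = tsq_word w (\<lambda>x. tsq x (int i) \<phi>)"

lemma tsq_word_append: "tsq_word (u @ v) \<phi> = tsq_word v (tsq_word u \<phi>)"
  by (induction u arbitrary: \<phi>) auto

lemma tsq_word_add: "tsq_word w (\<lambda>y. \<phi> y + \<psi> y) x = tsq_word w \<phi> x + tsq_word w \<psi> x"
  by (induction w arbitrary: \<phi> \<psi>) (auto simp: tsq_add)

lemma tsq_word_0 [simp]: "tsq_word w (\<lambda>y. 0) x = 0"
  by (induction w) auto

lemma tsq_word_sum:
  "tsq_word w (\<lambda>y. \<Sum>c\<in>C. k c * \<phi> c y) x = (\<Sum>c\<in>C. k c * tsq_word w (\<phi> c) x)"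
  by (induction w arbitrary: \<phi>) (auto simp: tsq_sum tsq_cmult)

lemma tsq_word_cong:
  assumes "\<And>y. length y = length x \<Longrightarrow> wt y = wt x + sum_list w \<Longrightarrow> \<phi> y = \<psi> y"
  shows "tsq_word w \<phi> x = tsq_word w \<psi> x"
  using assms
proof (induction w arbitrary: \<phi> \<psi>)
  case (Cons i w)
  show ?case unfolding tsq_word.simps
    by (rule Cons.IH, rule tsq_cong, rule Cons.prems) (auto simp: int_ops)
qed simp

lemma tsq_adem_nat:
  assumes "0 < i" "i < 2 * j"
  shows "tsq x (int j) (\<lambda>y. tsq y (int i) \<phi>)
    = (\<Sum>c = 0..i div 2. of_nat ((j - c - 1) choose (i - 2 * c))
        * tsq x (int c) (\<lambda>y. tsq y (int (i + j - c)) \<phi>))"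
proof -
  have "{0..int i div 2} = int ` {0..i div 2}"
    by (auto simp: image_int_atLeastAtMost zdiv_int)
  then have "tsq2 x (int i) (int j) \<phi> = (\<Sum>c\<in>{0..i div 2}. binom2 (int j - int c - 1) (int i - 2 * int c)
      * tsq2 x (int i + int j - int c) (int c) \<phi>)"
    unfolding tsq2_adem[of x "int i"] by (subst sum.reindex[symmetric, unfolded o_def]) auto
  also have "\<dots> = (\<Sum>c = 0..i div 2. of_nat ((j - c - 1) choose (i - 2 * c))
        * tsq2 x (int (i + j - c)) (int c) \<phi>)"
  proof (rule sum.cong[OF refl])
    fix c assume "c \<in> {0..i div 2}"
    then have c: "2 * c \<le> i" "c < j" using assms by auto
    have b: "binom2 (int p) (int q) = of_nat (p choose q)" for p q by (simp add: binom2_def)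
    from c have e: "int j - int c - 1 = int (j - c - 1)" "int i - 2 * int c = int (i - 2 * c)"
      "int i + int j - int c = int (i + j - c)" by auto
    show "binom2 (int j - int c - 1) (int i - 2 * int c) * tsq2 x (int i + int j - int c) (int c) \<phi>
      = of_nat ((j - c - 1) choose (i - 2 * c)) * tsq2 x (int (i + j - c)) (int c) \<phi>"
      unfolding e b ..
  qed
  finally show ?thesis unfolding tsq2_def .
qed

lemma adem_functional_tsq_word: "adem_functional (\<lambda>w. tsq_word w \<phi> x)"
  unfolding adem_functional_def
  by (auto simp: tsq_word_append tsq_adem_nat tsq_word_sum)

text \<open>The functions on words that come from functionals on the free unstable module on a generator
  of degree \<open>m\<close>: the second condition kills the words \<open>u Sq\<^sup>k v\<close> in which \<open>k\<close> is larger than the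
  degree of \<open>v\<close> applied to the generator.\<close>

definition unstable_functional :: "nat \<Rightarrow> (nat list \<Rightarrow> bit) \<Rightarrow> bool" where
  "unstable_functional m h \<longleftrightarrow> adem_functional h \<and> (\<forall>u k v. m + sum_list v < k \<longrightarrow> h (u @ k # v) = 0)"

lemma wt_replicate: "wt (replicate m 0) = m"
  by (induction m) auto

text \<open>The list of \<open>m\<close> zeros stands for \<open>u \<otimes> \<dots> \<otimes> u\<close>, a class of degree \<open>m\<close>.\<close>

lemma unstable_functional_tsq_word: "unstable_functional m (\<lambda>w. tsq_word w \<phi> (replicate m 0))"
  unfolding unstable_functional_def
proof (intro conjI allI impI adem_functional_tsq_word)
  fix u v :: "nat list" and k :: nat
  assume *: "m + sum_list v < k"
  have "tsq_word v (\<lambda>x. tsq x (int k) (tsq_word u \<phi>)) (replicate m 0) = tsq_word v (\<lambda>x. 0) (replicate m 0)"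
    using * by (intro tsq_word_cong tsq_unstable) (auto simp: wt_replicate)
  then show "tsq_word (u @ k # v) \<phi> (replicate m 0) = 0" by (simp add: tsq_word_append)
qed

text \<open>A functional on \<open>m\<close> tensor factors gives one on \<open>m + 1\<close> factors that reads off the
  coefficient of \<open>u\<close> in the first factor. Squares never bring \<open>u\<close> back once it has been raised to
  a power, so this construction commutes with all operations.\<close>

definition extend0 :: "(nat list \<Rightarrow> bit) \<Rightarrow> nat list \<Rightarrow> bit" where
  "extend0 \<phi> x = (case x of 0 # y \<Rightarrow> \<phi> y | _ \<Rightarrow> 0)"

lemma extend0_simps [simp]:
  "extend0 \<phi> [] = 0" "extend0 \<phi> (0 # y) = \<phi> y" "extend0 \<phi> (Suc i # y) = 0"
  by (simp_all add: extend0_def)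

lemma tsq_extend0: "tsq x k (extend0 \<phi>) = extend0 (\<lambda>y. tsq y k \<phi>) x"
proof (cases x)
  case (Cons i y)
  then show ?thesis by (cases i) simp_all
qed simp

lemma tsq_word_extend0: "tsq_word w (extend0 \<phi>) = extend0 (tsq_word w \<phi>)"
  by (induction w arbitrary: \<phi>) (simp_all add: tsq_extend0)

text \<open>Let \<open>m\<close> be replaced by \<open>m + 1\<close>. Words of excess exactly \<open>m + 1\<close> are top squares, so they
  produce only tensors without a factor \<open>u\<close>, and values on them amount to values on shorter words,
  given by a function of \<open>map Suc y\<close> (\<open>\<phi>2\<close> below). Words of smaller excess are told apart by the
  tensors that begin with \<open>u\<close>, to which the case of \<open>m\<close> factors applies (\<open>\<phi>3\<close>). A functional
  concentrated on tensors that begin with \<open>u\<close> does not see the words of excess \<open>m + 1\<close>, so it can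
  be used to correct the values on the others.\<close>

lemma exists_functional:
  "\<exists>\<phi>. \<forall>w. admissible w \<longrightarrow> excess_le m w \<longrightarrow> sum_list w \<le> d \<longrightarrow> tsq_word w \<phi> (replicate m 0) = g w"
proof (induction m arbitrary: d g)
  case 0
  show ?case by (rule exI[of _ "\<lambda>_. g []"]) (auto dest: admissible_excess_0)
next
  case (Suc m)
  note IH = Suc.IH
  show ?case
  proof (induction d arbitrary: g)
    case 0
    have "tsq_word w (\<lambda>_. g []) (replicate (Suc m) 0) = g w"
      if "admissible w" "sum_list w \<le> 0" for w
      using that by (cases w) (auto dest: admissible_ConsD)
    then show ?case by blast
  next
    case (Suc d)
    let ?o = "replicate (Suc m) (0::nat)"
    have wt: "wt ?o = Suc m" by (rule wt_replicate)
    obtain \<phi>1 where \<phi>1: "\<And>w. admissible w \<Longrightarrow> excess_le (Suc m) w \<Longrightarrow> sum_list w \<le> d \<Longrightarrow>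
        tsq_word w \<phi>1 ?o = g ((Suc m + sum_list w) # w)"
      using Suc.IH[of "\<lambda>w. g ((Suc m + sum_list w) # w)"] by blast
    define \<phi>2 where "\<phi>2 = (\<lambda>y. if 0 \<in> set y then 0 else \<phi>1 (map (\<lambda>i. i - 1) y))"
    have \<phi>2: "\<phi>2 (map Suc y) = \<phi>1 y" for y
      by (auto simp: \<phi>2_def o_def)
    obtain \<phi>3 where \<phi>3: "\<And>w. admissible w \<Longrightarrow> excess_le m w \<Longrightarrow> sum_list w \<le> Suc d \<Longrightarrow>
        tsq_word w \<phi>3 (replicate m 0) = g w + tsq_word w \<phi>2 ?o"
      using IH[of "Suc d" "\<lambda>w. g w + tsq_word w \<phi>2 ?o"] by blast
    have "tsq_word w (\<lambda>y. \<phi>2 y + extend0 \<phi>3 y) ?o = g w"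
      if w: "admissible w" "excess_le (Suc m) w" "sum_list w \<le> Suc d" for w
    proof (cases "excess_le m w")
      case True
      then show ?thesis using \<phi>3[of w] w
        by (simp add: tsq_word_add tsq_word_extend0 ac_simps)
    next
      case False
      then obtain v where v: "w = (Suc m + sum_list v) # v"
        using w(2) by (cases w) auto
      have "tsq_word w (\<lambda>y. \<phi>2 y + extend0 \<phi>3 y) ?o
          = tsq_word v (\<lambda>x. tsq x (int (Suc m + sum_list v)) (\<lambda>y. \<phi>2 y + extend0 \<phi>3 y)) ?o"
        by (simp add: v)
      also have "\<dots> = tsq_word v \<phi>1 ?o"
      proof (rule tsq_word_cong)
        fix y assume "wt y = wt ?o + sum_list v"
        then have "tsq y (int (Suc m + sum_list v)) (\<lambda>y. \<phi>2 y + extend0 \<phi>3 y)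
            = \<phi>2 (map Suc y) + extend0 \<phi>3 (map Suc y)"
          using tsq_top[of y] wt by simp
        also have "\<dots> = \<phi>1 y" unfolding \<phi>2 by (cases y) simp_all
        finally show "tsq y (int (Suc m + sum_list v)) (\<lambda>y. \<phi>2 y + extend0 \<phi>3 y) = \<phi>1 y" .
      qed
      also have "\<dots> = g w"
        using w \<phi>1[of v] admissible_ConsD[of _ v] admissible_excess_tl[of _ v] by (simp add: v)
      finally show ?thesis .
    qed
    then show ?case by blast
  qed
qed

section \<open>The admissible basis and the explicit Brown-Gitler modules\<close>

lemma bg_carrier_extensional: "\<phi> \<in> bg_carrier n m \<Longrightarrow> \<phi> \<in> extensional (bg_dom n m)"
  by (simp add: bg_carrier_def)

lemma bg_carrier_add:
  "\<phi> \<in> bg_carrier n m \<Longrightarrow> \<theta> \<in> bg_dom n m \<Longrightarrow> \<eta> \<in> bg_dom n m \<Longrightarrow> \<phi> (\<theta> \<oplus>\<^bsub>\<A>\<^esub> \<eta>) = \<phi> \<theta> + \<phi> \<eta>"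
  unfolding bg_carrier_def by blast

lemma bg_carrier_unstable:
  "\<phi> \<in> bg_carrier n m \<Longrightarrow> m + e < k \<Longrightarrow> c + k + e + m = n \<Longrightarrow> \<theta> \<in> steenrod_deg c \<Longrightarrow> \<eta> \<in> steenrod_deg e
    \<Longrightarrow> \<phi> (\<theta> \<otimes>\<^bsub>\<A>\<^esub> Sq k \<otimes>\<^bsub>\<A>\<^esub> \<eta>) = 0"
  unfolding bg_carrier_def by blast

lemma bg_carrier_unstable_Sqs:
  assumes "\<phi> \<in> bg_carrier n m" "m + sum_list v < k" "k + sum_list v + m = n"
  shows "\<phi> (Sqs (k # v)) = 0"
  using bg_carrier_unstable[OF assms(1,2) _ steenrod_deg_one Sqs_deg] assms(3)
  by (simp add: Sqs_Cons steenrod_deg_Sq[THEN steenrod_deg_closed])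

lemma bg_carrier_homogeneous:
  assumes "\<phi> \<in> bg_carrier n m" "m \<le> n" "homogeneous (n - m) f"
  shows "\<phi> (steenrod_class f) = lin (\<lambda>w. \<phi> (Sqs w)) f"
  using assms(3)
proof (induction f rule: homogeneous_induct)
  case zero
  show ?case using bg_carrier_zero[OF assms(1)] by (simp flip: steenrod_zero)
next
  case (add f w)
  have "steenrod_class f \<in> bg_dom n m" "Sqs w \<in> bg_dom n m"
    using add assms(2) Sqs_deg[of w] by (auto simp: bg_dom_def steenrod_deg_iff)
  then show ?case
    using bg_carrier_add[OF assms(1)] add by (simp add: Sqs_def flip: steenrod_class_add)
qed

lemma bg_carrier_adem:
  assumes "\<phi> \<in> bg_carrier n m" "0 < i" "i < 2 * j" "sum_list (u @ i # j # v) + m = n"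
  shows "\<phi> (Sqs (u @ i # j # v))
    = (\<Sum>c = 0..i div 2. of_nat ((j - c - 1) choose (i - 2 * c)) * \<phi> (Sqs (u @ (i + j - c) # c # v)))"
proof -
  have "homogeneous (sum_list u + (i + j) + sum_list v) (monom_word u * adem i j * monom_word v)"
    using assms(2,3) by (intro homogeneous_mult homogeneous_adem) auto
  moreover have "sum_list u + (i + j) + sum_list v = n - m" "m \<le> n" using assms(4) by auto
  ultimately have "\<phi> (steenrod_class (monom_word u * adem i j * monom_word v))
      = lin (\<lambda>w. \<phi> (Sqs w)) (monom_word u * adem i j * monom_word v)"
    using assms(1) by (simp add: bg_carrier_homogeneous)
  then show ?thesis
    using adem_context_zero[OF assms(2,3)] bg_carrier_zero[OF assms(1)] by (simp add: lin_adem bit_add_eq_0_iff)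
qed

text \<open>Both the use of an Adem relation and the deletion of a letter 0 decrease the moment \<open>\<Sum> j
  i\<^sub>j\<close> of a word \<open>(i\<^sub>1, i\<^sub>2, \<dots>)\<close> plus its length, so rewriting to admissible words ends.\<close>

primrec moment :: "nat list \<Rightarrow> nat" where
  "moment [] = 0"
| "moment (i # w) = i + sum_list w + moment w"

lemma moment_append: "moment (u @ v) = moment u + moment v + length u * sum_list v"
  by (induction u) (simp_all add: add_mult_distrib)

lemma not_admissible_cases:
  assumes "\<not> admissible w"
  obtains u v where "w = u @ 0 # v" | u i j v where "w = u @ i # j # v" "0 < i" "i < 2 * j"
proof -
  have "(\<exists>u v. w = u @ 0 # v) \<or> (\<exists>u i j v. w = u @ i # j # v \<and> 0 < i \<and> i < 2 * j)"
    using assms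
  proof (induction w rule: admissible.induct)
    case (2 i)
    then show ?case by (metis admissible.simps(2) append_Nil gr0I)
  next
    case (3 i j w)
    show ?case
    proof (cases "admissible (j # w)")
      case True
      then have "i < 2 * j" using 3 by auto
      then show ?thesis by (metis append_Nil gr0I)
    next
      case False
      then show ?thesis using 3(1) by (metis append_Cons)
    qed
  qed simp
  then show ?thesis using that by blast
qed

text \<open>Admissible words of excess at most \<open>m\<close> span: other words are rewritten by Adem relations,
  and admissible words of larger excess are killed by instability.\<close>

lemma bg_carrier_vanishes:
  assumes \<phi>: "\<phi> \<in> bg_carrier n m"
    and adm: "\<And>w. admissible w \<Longrightarrow> excess_le m w \<Longrightarrow> sum_list w + m = n \<Longrightarrow> \<phi> (Sqs w) = 0"
    and "\<theta> \<in> bg_dom n m"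
  shows "\<phi> \<theta> = 0"
proof (cases "m \<le> n")
  case False
  then show ?thesis using assms(3) bg_carrier_zero[OF \<phi>] by (simp add: bg_dom_def)
next
  case True
  have words: "sum_list w + m = n \<Longrightarrow> \<phi> (Sqs w) = 0" for w
  proof (induction "moment w + length w" arbitrary: w rule: less_induct)
    case less
    show ?case
    proof (cases "admissible w")
      case True
      show ?thesis
      proof (cases "excess_le m w")
        case True
        with \<open>admissible w\<close> less.prems show ?thesis by (intro adm)
      next
        case False
        then obtain k v where "w = k # v" "m + sum_list v < k" by (cases w) auto
        then show ?thesis using less.prems \<phi> by (auto intro!: bg_carrier_unstable_Sqs)
      qed
    next
      case False
      then show ?thesis
      proof (cases rule: not_admissible_cases)
        case (1 u v)
        then show ?thesis using less.hyps[of "u @ v"] less.prems by (simp add: Sqs_drop0 moment_append)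
      next
        case (2 u i j v)
        have "\<phi> (Sqs (u @ (i + j - c) # c # v)) = 0" if "c \<in> {0..i div 2}" for c
          using that 2 less.prems by (intro less.hyps) (auto simp: moment_append)
        then show ?thesis
          using bg_carrier_adem[OF \<phi> 2(2,3)] less.prems by (simp add: 2(1))
      qed
    qed
  qed
  obtain f where f: "homogeneous (n - m) f" "\<theta> = steenrod_class f"
    using True assms(3) by (auto simp: bg_dom_def steenrod_deg_iff)
  have "lin (\<lambda>w. \<phi> (Sqs w)) f = 0"
    unfolding lin_def using f(1) True words by (intro sum.neutral) (auto simp: homogeneous_def)
  then show ?thesis using bg_carrier_homogeneous[OF \<phi> True f(1)] by (simp add: f(2))
qed

lemma bg_carrier_eqI:
  assumes \<phi>: "\<phi> \<in> bg_carrier n m" and \<psi>: "\<psi> \<in> bg_carrier n m"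
    and "\<And>w. admissible w \<Longrightarrow> excess_le m w \<Longrightarrow> sum_list w + m = n \<Longrightarrow> \<phi> (Sqs w) = \<psi> (Sqs w)"
  shows "\<phi> = \<psi>"
proof (rule extensionalityI[of _ "bg_dom n m"])
  show "\<phi> \<in> extensional (bg_dom n m)" "\<psi> \<in> extensional (bg_dom n m)"
    using \<phi> \<psi> by (simp_all add: bg_carrier_extensional)
  fix \<theta> assume \<theta>: "\<theta> \<in> bg_dom n m"
  have "monoid (gr (bg_module n) m)"
    using bg_module_group[of n m] by (simp add: comm_group_def group_def)
  then have "(\<lambda>\<theta>\<in>bg_dom n m. \<phi> \<theta> + \<psi> \<theta>) \<in> bg_carrier n m"
    using \<phi> \<psi> monoid.m_closed[of "gr (bg_module n) m" \<phi> \<psi>] by (simp add: bg_module_def)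
  then have "(\<lambda>\<theta>\<in>bg_dom n m. \<phi> \<theta> + \<psi> \<theta>) \<theta> = 0"
  proof (rule bg_carrier_vanishes[OF _ _ \<theta>])
    fix w assume w: "admissible w" "excess_le m w" "sum_list w + m = n"
    then have "Sqs w \<in> bg_dom n m" using Sqs_deg[of w] by (auto simp: bg_dom_def)
    then show "(\<lambda>\<theta>\<in>bg_dom n m. \<phi> \<theta> + \<psi> \<theta>) (Sqs w) = 0"
      using assms(3)[OF w] by (simp add: bit_add_self)
  qed
  then show "\<phi> \<theta> = \<psi> \<theta>" using \<theta> by (simp add: bit_add_eq_0_iff)
qed

text \<open>There are finitely many admissible words in each degree, and the functionals are determined
  by the subset of those words on which they are 1.\<close>

lemma finite_bg_carrier: "finite (bg_carrier n m)"
proof -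
  define W where "W = {w. admissible w \<and> sum_list w \<le> n}"
  have "set w \<subseteq> {0..n} \<and> length w \<le> n" if "w \<in> W" for w
  proof -
    have "length w \<le> sum_list w" if "admissible w" for w
      using that
    proof (induction w)
      case (Cons i w)
      then have "length w \<le> sum_list w" "0 < i" using admissible_ConsD by blast+
      then show ?case by simp
    qed simp
    then have "length w \<le> sum_list w" "sum_list w \<le> n" using that by (simp_all add: W_def)
    then show ?thesis using member_le_sum_list[of _ w] by (force intro: order_trans)
  qed
  then have "W \<subseteq> {w. set w \<subseteq> {0..n} \<and> length w \<le> n}" by blast
  then have "finite W" by (rule finite_subset) (rule finite_lists_length_le, simp)
  moreover have "inj_on (\<lambda>\<phi>. {w \<in> W. \<phi> (Sqs w) = 1}) (bg_carrier n m)"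
  proof (rule inj_onI, rule bg_carrier_eqI)
    fix \<phi> \<psi> :: "free_sq set \<Rightarrow> bit" and w assume "{w \<in> W. \<phi> (Sqs w) = 1} = {w \<in> W. \<psi> (Sqs w) = 1}" "admissible w" "sum_list w + m = n"
    moreover from this have "w \<in> W" by (simp add: W_def)
    ultimately have "\<phi> (Sqs w) = 1 \<longleftrightarrow> \<psi> (Sqs w) = 1" by blast
    then show "\<phi> (Sqs w) = \<psi> (Sqs w)" by (metis bit_not_one_iff)
  qed
  moreover have "(\<lambda>\<phi>. {w \<in> W. \<phi> (Sqs w) = 1}) ` bg_carrier n m \<subseteq> Pow W" by blast
  ultimately show ?thesis by (meson finite_Pow_iff inj_on_finite)
qed

lemma bg_dom_class: "\<theta> \<in> bg_dom n m \<Longrightarrow> \<exists>f. \<theta> = steenrod_class f"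
  by (auto simp: bg_dom_def steenrod_deg_iff steenrod_zero split: if_splits)

lemma functional_of_bg_carrier:
  assumes "unstable_functional m h"
  shows "(\<lambda>\<theta>\<in>bg_dom n m. functional_of h \<theta>) \<in> bg_carrier n m"
  unfolding bg_carrier_def
proof (intro CollectI conjI ballI allI impI)
  have h: "functional_of h (steenrod_class f) = lin h f" for f
    using assms by (intro functional_of_class) (simp add: unstable_functional_def)
  fix \<theta> \<eta> assume *: "\<theta> \<in> bg_dom n m" "\<eta> \<in> bg_dom n m"
  then obtain f g where "\<theta> = steenrod_class f" "\<eta> = steenrod_class g" by (metis bg_dom_class)
  then show "restrict (functional_of h) (bg_dom n m) (\<theta> \<oplus>\<^bsub>\<A>\<^esub> \<eta>)
      = restrict (functional_of h) (bg_dom n m) \<theta> + restrict (functional_of h) (bg_dom n m) \<eta>"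
    using bg_dom_add[OF *] * by (simp add: steenrod_class_add h)
next
  have h: "functional_of h (steenrod_class f) = lin h f" for f
    using assms by (intro functional_of_class) (simp add: unstable_functional_def)
  fix c k e \<theta> \<eta>
  assume *: "m + e < k" "c + k + e + m = n" "\<theta> \<in> steenrod_deg c" "\<eta> \<in> steenrod_deg e"
  then obtain f g where fg: "\<theta> = steenrod_class f" "\<eta> = steenrod_class g" "homogeneous e g"
    by (metis steenrod_deg_iff)
  have "lin h (f * monom_word [k] * g) = 0"
  proof (induction f rule: free_sq_induct)
    case (word w)
    have "lin h (monom_word w * monom_word [k] * g) = lin (\<lambda>v. h (w @ k # v)) g"
      using lin_context[of h "w @ [k]" g "[]"] by (simp flip: one_eq_monom_word)
    also have "\<dots> = 0"
      unfolding lin_def using assms fg(3) *(1)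
      by (intro sum.neutral) (auto simp: homogeneous_def unstable_functional_def)
    finally show ?case .
  qed (simp_all add: distrib_right)
  then show "restrict (functional_of h) (bg_dom n m) (\<theta> \<otimes>\<^bsub>\<A>\<^esub> Sq k \<otimes>\<^bsub>\<A>\<^esub> \<eta>) = 0"
    using bg_dom_triple[OF *(2-4)] by (simp add: fg Sq_def gen_eq_monom_word steenrod_class_mult h)
qed simp

text \<open>Admissible words of excess at most \<open>m\<close> are linearly independent in \<open>F(m)\<close>.\<close>

lemma exists_bg_carrier:
  obtains \<phi> where "\<phi> \<in> bg_carrier n m"
    "\<And>w. admissible w \<Longrightarrow> excess_le m w \<Longrightarrow> sum_list w + m = n \<Longrightarrow> \<phi> (Sqs w) = g w"
proof -
  obtain \<psi> where \<psi>: "\<And>w. admissible w \<Longrightarrow> excess_le m w \<Longrightarrow> sum_list w \<le> n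
      \<Longrightarrow> tsq_word w \<psi> (replicate m 0) = g w"
    using exists_functional[of m n g] by blast
  define h where "h = (\<lambda>w. tsq_word w \<psi> (replicate m 0))"
  have u: "unstable_functional m h" unfolding h_def by (rule unstable_functional_tsq_word)
  show ?thesis
  proof (rule that[OF functional_of_bg_carrier[OF u]])
    fix w assume w: "admissible w" "excess_le m w" "sum_list w + m = n"
    then have "Sqs w \<in> bg_dom n m" using Sqs_deg[of w] by (auto simp: bg_dom_def)
    moreover have "functional_of h (Sqs w) = h w"
      using u by (simp add: Sqs_def functional_of_class unstable_functional_def)
    ultimately show "restrict (functional_of h) (bg_dom n m) (Sqs w) = g w"
      using \<psi>[of w] w by (simp add: h_def)
  qed
qed

lemma bg_dom_mult_left:
  assumes "\<theta> \<in> steenrod_deg (p - n)" "n \<le> p" "\<eta> \<in> bg_dom n m"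
  shows "\<theta> \<otimes>\<^bsub>\<A>\<^esub> \<eta> \<in> bg_dom p m"
proof (cases "m \<le> n")
  case True
  then have "\<theta> \<otimes>\<^bsub>\<A>\<^esub> \<eta> \<in> steenrod_deg (p - n + (n - m))"
    using assms by (intro steenrod_deg_mult) (auto simp: bg_dom_def)
  then show ?thesis using True assms(2) by (simp add: bg_dom_def)
next
  case False
  then show ?thesis using assms bg_dom_zero by (simp add: bg_dom_def[of n m] steenrod_deg_closed)
qed

text \<open>Precomposition with left multiplication, which is \<open>\<bullet>\<theta>\<close> for the explicit modules.\<close>

lemma bg_carrier_precompose:
  assumes \<phi>: "\<phi> \<in> bg_carrier p m" and \<theta>: "\<theta> \<in> steenrod_deg (p - n)" and "n \<le> p"
  shows "(\<lambda>\<eta>\<in>bg_dom n m. \<phi> (\<theta> \<otimes>\<^bsub>\<A>\<^esub> \<eta>)) \<in> bg_carrier n m"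
  unfolding bg_carrier_def
proof (intro CollectI conjI ballI allI impI)
  fix \<eta> \<zeta> assume *: "\<eta> \<in> bg_dom n m" "\<zeta> \<in> bg_dom n m"
  then show "(\<lambda>\<eta>\<in>bg_dom n m. \<phi> (\<theta> \<otimes>\<^bsub>\<A>\<^esub> \<eta>)) (\<eta> \<oplus>\<^bsub>\<A>\<^esub> \<zeta>)
      = (\<lambda>\<eta>\<in>bg_dom n m. \<phi> (\<theta> \<otimes>\<^bsub>\<A>\<^esub> \<eta>)) \<eta> + (\<lambda>\<eta>\<in>bg_dom n m. \<phi> (\<theta> \<otimes>\<^bsub>\<A>\<^esub> \<eta>)) \<zeta>"
    using bg_carrier_add[OF \<phi> bg_dom_mult_left[OF \<theta> \<open>n \<le> p\<close>] bg_dom_mult_left[OF \<theta> \<open>n \<le> p\<close>]] \<theta>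
    by (simp add: bg_dom_add steenrod.r_distr bg_dom_carr steenrod_deg_closed)
next
  fix c k e \<eta> \<zeta>
  assume *: "m + e < k" "c + k + e + m = n" "\<eta> \<in> steenrod_deg c" "\<zeta> \<in> steenrod_deg e"
  have "\<phi> (\<theta> \<otimes>\<^bsub>\<A>\<^esub> \<eta> \<otimes>\<^bsub>\<A>\<^esub> Sq k \<otimes>\<^bsub>\<A>\<^esub> \<zeta>) = 0"
    using * \<open>n \<le> p\<close> by (intro bg_carrier_unstable[OF \<phi> *(1) _ steenrod_deg_mult[OF \<theta> *(3)]]) auto
  then show "(\<lambda>\<eta>\<in>bg_dom n m. \<phi> (\<theta> \<otimes>\<^bsub>\<A>\<^esub> \<eta>)) (\<eta> \<otimes>\<^bsub>\<A>\<^esub> Sq k \<otimes>\<^bsub>\<A>\<^esub> \<zeta>) = 0"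
    using bg_dom_triple[OF *(2-4)] \<theta> *
    by (simp add: steenrod.m_assoc steenrod_deg_closed steenrod_deg_Sq[THEN steenrod_deg_closed])
qed simp

section \<open>Exactness at the level of functionals\<close>

text \<open>The composite of the two maps is zero since \<open>Sq\<^sup>1 Sq\<^sup>1 = 0\<close> and since \<open>Sq\<^sup>1 Sq\<^bsup>2k\<^esup> = Sq\<^bsup>2k +
  1\<^esup>\<close> vanishes on classes of degree \<open>2k\<close>.\<close>

lemma bg_composite_zero:
  assumes \<phi>: "\<phi> \<in> bg_carrier (n + 2) m"
  shows "\<eta> \<in> bg_dom n m \<Longrightarrow> \<phi> (Sq 1 \<otimes>\<^bsub>\<A>\<^esub> (Sq 1 \<otimes>\<^bsub>\<A>\<^esub> \<eta>)) = 0"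
    and "n + 1 = 4 * k \<Longrightarrow> \<eta> \<in> bg_dom (2 * k) m \<Longrightarrow> \<phi> (Sq 1 \<otimes>\<^bsub>\<A>\<^esub> (Sq (2 * k) \<otimes>\<^bsub>\<A>\<^esub> \<eta>)) = 0"
proof -
  note [simp] = bg_dom_carr steenrod_deg_Sq[THEN steenrod_deg_closed] steenrod.m_assoc[symmetric]
  assume "\<eta> \<in> bg_dom n m"
  moreover have "Sq 1 \<otimes>\<^bsub>\<A>\<^esub> Sq 1 = \<zero>\<^bsub>\<A>\<^esub>"
    using Sq_1_Sq[of 1 "[]"] by (simp add: Sq_eq Sqs_mult)
  ultimately show "\<phi> (Sq 1 \<otimes>\<^bsub>\<A>\<^esub> (Sq 1 \<otimes>\<^bsub>\<A>\<^esub> \<eta>)) = 0"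
    using bg_carrier_zero[OF \<phi>] by simp
next
  note [simp] = bg_dom_carr steenrod_deg_Sq[THEN steenrod_deg_closed] steenrod.m_assoc[symmetric]
  assume k: "n + 1 = 4 * k" and \<eta>: "\<eta> \<in> bg_dom (2 * k) m"
  have eq: "Sq 1 \<otimes>\<^bsub>\<A>\<^esub> Sq (2 * k) = Sq (2 * k + 1)"
    using Sq_1_Sq[of "2 * k" "[]"] by (simp add: Sq_eq Sqs_mult)
  show "\<phi> (Sq 1 \<otimes>\<^bsub>\<A>\<^esub> (Sq (2 * k) \<otimes>\<^bsub>\<A>\<^esub> \<eta>)) = 0"
  proof (cases "m \<le> 2 * k")
    case True
    then have "\<phi> (\<one>\<^bsub>\<A>\<^esub> \<otimes>\<^bsub>\<A>\<^esub> Sq (2 * k + 1) \<otimes>\<^bsub>\<A>\<^esub> \<eta>) = 0"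
      using \<eta> k by (intro bg_carrier_unstable[OF \<phi> _ _ steenrod_deg_one, of "2 * k - m"]) (auto simp: bg_dom_def)
    then show ?thesis using \<eta> eq by simp
  next
    case False
    then show ?thesis using \<eta> bg_carrier_zero[OF \<phi>] by (simp add: bg_dom_def)
  qed
qed

text \<open>The homology of \<open>Sq\<^sup>1\<close> on the free unstable module, in dual form. The lift \<open>\<psi>\<close> is defined on
  the admissible basis by inverting \<open>Sq\<^sup>1\<close> on words with odd first letter and the top square on
  words of maximal excess with even first letter; both formulas are then compared with \<open>\<phi>\<close> and \<open>\<chi>\<close>
  on admissible words only.\<close>

lemma bg_exact:
  assumes \<phi>: "\<phi> \<in> bg_carrier (n + 1) m"
    and \<chi>: "\<And>k. n + 2 = 4 * k \<Longrightarrow> \<chi> \<in> bg_carrier (2 * k) m"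
    and z1: "\<And>\<eta>. \<eta> \<in> bg_dom n m \<Longrightarrow> \<phi> (Sq 1 \<otimes>\<^bsub>\<A>\<^esub> \<eta>) = 0"
    and z2: "\<And>k \<eta>. n + 1 = 4 * k \<Longrightarrow> \<eta> \<in> bg_dom (2 * k) m \<Longrightarrow> \<phi> (Sq (2 * k) \<otimes>\<^bsub>\<A>\<^esub> \<eta>) = 0"
  shows "\<exists>\<psi>\<in>bg_carrier (n + 2) m.
    (\<forall>\<eta>\<in>bg_dom (n + 1) m. \<psi> (Sq 1 \<otimes>\<^bsub>\<A>\<^esub> \<eta>) = \<phi> \<eta>) \<and>
    (\<forall>k. n + 2 = 4 * k \<longrightarrow> (\<forall>\<eta>\<in>bg_dom (2 * k) m. \<psi> (Sq (2 * k) \<otimes>\<^bsub>\<A>\<^esub> \<eta>) = \<chi> \<eta>))"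
proof -
  \<comment> \<open>In degree \<open>n + 2\<close> the condition \<open>2 i = n + 2\<close> says that the excess of \<open>i # v\<close> is \<open>m\<close>.\<close>
  define g where "g w = (case w of [] \<Rightarrow> 0 | i # v \<Rightarrow>
      if odd i then \<phi> (Sqs ((i - 1) # v)) else if 2 * i = n + 2 then \<chi> (Sqs v) else 0)" for w
  obtain \<psi> where \<psi>: "\<psi> \<in> bg_carrier (n + 2) m"
    "\<And>w. admissible w \<Longrightarrow> excess_le m w \<Longrightarrow> sum_list w + m = n + 2 \<Longrightarrow> \<psi> (Sqs w) = g w"
    using exists_bg_carrier by blast
  have dom: "Sqs w \<in> bg_dom p m" if "sum_list w + m = p" for w p
    using that Sqs_deg[of w] by (auto simp: bg_dom_def)
  have "(\<lambda>\<eta>\<in>bg_dom (n + 1) m. \<psi> (Sq 1 \<otimes>\<^bsub>\<A>\<^esub> \<eta>)) = \<phi>"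
  proof (rule bg_carrier_eqI[OF _ \<phi>])
    show "(\<lambda>\<eta>\<in>bg_dom (n + 1) m. \<psi> (Sq 1 \<otimes>\<^bsub>\<A>\<^esub> \<eta>)) \<in> bg_carrier (n + 1) m"
      using \<psi>(1) steenrod_deg_Sq[of 1] by (intro bg_carrier_precompose[of \<psi> "n + 2"]) auto
    fix w assume w: "admissible w" "excess_le m w" "sum_list w + m = n + 1"
    have "\<psi> (Sqs (1 # w)) = \<phi> (Sqs w)"
    proof (cases w)
      case Nil
      then have "\<psi> (Sqs [1]) = g [1]" using w by (intro \<psi>(2)) auto
      then show ?thesis using Sqs_drop0[of "[]" "[]"] by (simp add: Nil g_def)
    next
      case (Cons i v)
      consider "odd i" | "even i" "i < m + sum_list v" | "even i" "i = m + sum_list v"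
        using w(2) Cons by force
      then show ?thesis
      proof cases
        case 1
        then obtain j where j: "i = Suc j" by (cases i) auto
        have "\<phi> (Sq 1 \<otimes>\<^bsub>\<A>\<^esub> Sqs (j # v)) = 0"
          using w(3) by (intro z1 dom) (simp add: Cons j)
        then have "\<phi> (Sqs w) = 0" using Sq_1_Sq[of j v] 1 by (simp add: Cons j Sq_eq Sqs_mult)
        moreover have "\<psi> (Sqs (1 # w)) = 0"
          using Sq_1_Sq[of i v] 1 bg_carrier_zero[OF \<psi>(1)] by (simp add: Cons)
        ultimately show ?thesis by simp
      next
        case 2
        have "admissible (Suc i # v)" using w(1) Cons by (cases v) auto
        then have "\<psi> (Sqs (Suc i # v)) = g (Suc i # v)" using 2 w(3) by (intro \<psi>(2)) (auto simp: Cons)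
        then show ?thesis using 2 Sq_1_Sq[of i v] by (simp add: Cons g_def)
      next
        case 3
        then obtain k where k: "i = 2 * k" by blast
        then have "n + 1 = 4 * k" "sum_list v + m = 2 * k" using 3 w(3) Cons by auto
        then have "\<phi> (Sq (2 * k) \<otimes>\<^bsub>\<A>\<^esub> Sqs v) = 0" by (intro z2 dom)
        then have "\<phi> (Sqs w) = 0" by (simp add: Cons k Sqs_Cons)
        moreover have "\<psi> (Sqs (Suc i # v)) = 0"
          using 3 w(3) by (intro bg_carrier_unstable_Sqs[OF \<psi>(1)]) (auto simp: Cons)
        ultimately show ?thesis using Sq_1_Sq[of i v] 3 by (simp add: Cons)
      qed
    qed
    then show "(\<lambda>\<eta>\<in>bg_dom (n + 1) m. \<psi> (Sq 1 \<otimes>\<^bsub>\<A>\<^esub> \<eta>)) (Sqs w) = \<phi> (Sqs w)"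
      using dom[OF w(3)] by (simp add: Sqs_Cons)
  qed
  then have 1: "\<psi> (Sq 1 \<otimes>\<^bsub>\<A>\<^esub> \<eta>) = \<phi> \<eta>" if "\<eta> \<in> bg_dom (n + 1) m" for \<eta>
    using that by (metis restrict_apply')
  have 2: "\<psi> (Sq (2 * k) \<otimes>\<^bsub>\<A>\<^esub> \<eta>) = \<chi> \<eta>" if k: "n + 2 = 4 * k" and \<eta>: "\<eta> \<in> bg_dom (2 * k) m" for k \<eta>
  proof -
    have "(\<lambda>\<eta>\<in>bg_dom (2 * k) m. \<psi> (Sq (2 * k) \<otimes>\<^bsub>\<A>\<^esub> \<eta>)) = \<chi>"
    proof (rule bg_carrier_eqI[OF _ \<chi>[OF k]])
      show "(\<lambda>\<eta>\<in>bg_dom (2 * k) m. \<psi> (Sq (2 * k) \<otimes>\<^bsub>\<A>\<^esub> \<eta>)) \<in> bg_carrier (2 * k) m"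
        using k steenrod_deg_Sq[of "2 * k"] by (intro bg_carrier_precompose[OF \<psi>(1)]) auto
      fix w assume w: "admissible w" "excess_le m w" "sum_list w + m = 2 * k"
      have "admissible (2 * k # w)"
      proof -
        have "0 < m + sum_list w" "m + sum_list w = 2 * k" using w(3) k by auto
        then show ?thesis using admissible_top_Cons[OF w(1,2)] by simp
      qed
      then have "\<psi> (Sqs (2 * k # w)) = g (2 * k # w)"
        using w(3) k by (intro \<psi>(2)) auto
      then show "(\<lambda>\<eta>\<in>bg_dom (2 * k) m. \<psi> (Sq (2 * k) \<otimes>\<^bsub>\<A>\<^esub> \<eta>)) (Sqs w) = \<chi> (Sqs w)"
        using dom[OF w(3)] k by (simp add: g_def Sqs_Cons)
    qed
    then show ?thesis using \<eta> by (metis restrict_apply')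
  qed
  show ?thesis by (intro bexI[OF _ \<psi>(1)] conjI allI impI ballI) (rule 1 2; assumption)+
qed

section \<open>Unstable modules and their morphisms\<close>

lemma unstable_group: "unstable M \<Longrightarrow> comm_group (gr M n)"
  by (simp add: unstable_def steenrod_module_def)

lemma unstable_grp: "unstable M \<Longrightarrow> group (gr M n)"
  using unstable_group[of M n] by (simp add: comm_group_def)

lemma act_hom: "unstable M \<Longrightarrow> \<theta> \<in> steenrod_deg d \<Longrightarrow> act M d n \<theta> \<in> hom (gr M n) (gr M (n + d))"
  by (simp add: unstable_def steenrod_module_def)

lemma act_closed:
  "unstable M \<Longrightarrow> \<theta> \<in> steenrod_deg d \<Longrightarrow> x \<in> carrier (gr M n) \<Longrightarrow> act M d n \<theta> x \<in> carrier (gr M (n + d))"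
  using act_hom[of M \<theta> d n] by (auto simp: hom_def)

lemma act_one: "unstable M \<Longrightarrow> \<theta> \<in> steenrod_deg d \<Longrightarrow> act M d n \<theta> \<one>\<^bsub>gr M n\<^esub> = \<one>\<^bsub>gr M (n + d)\<^esub>"
  using hom_one[OF act_hom unstable_grp unstable_grp] by blast

lemma act_add:
  "unstable M \<Longrightarrow> \<theta> \<in> steenrod_deg d \<Longrightarrow> \<eta> \<in> steenrod_deg d \<Longrightarrow> x \<in> carrier (gr M n) \<Longrightarrow>
    act M d n (\<theta> \<oplus>\<^bsub>\<A>\<^esub> \<eta>) x = act M d n \<theta> x \<otimes>\<^bsub>gr M (n + d)\<^esub> act M d n \<eta> x"
  unfolding unstable_def steenrod_module_def by blast

lemma act_mult:
  "unstable M \<Longrightarrow> \<theta> \<in> steenrod_deg d \<Longrightarrow> \<eta> \<in> steenrod_deg e \<Longrightarrow> x \<in> carrier (gr M n) \<Longrightarrow>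
    act M (d + e) n (\<theta> \<otimes>\<^bsub>\<A>\<^esub> \<eta>) x = act M d (n + e) \<theta> (act M e n \<eta> x)"
  unfolding unstable_def steenrod_module_def by blast

lemma act_unit: "unstable M \<Longrightarrow> x \<in> carrier (gr M n) \<Longrightarrow> act M 0 n \<one>\<^bsub>\<A>\<^esub> x = x"
  unfolding unstable_def steenrod_module_def by blast

lemma act_Sq_unstable:
  "unstable M \<Longrightarrow> x \<in> carrier (gr M n) \<Longrightarrow> n < k \<Longrightarrow> act M k n (Sq k) x = \<one>\<^bsub>gr M (n + k)\<^esub>"
  unfolding unstable_def by blast

lemma unstableI:
  assumes "\<And>n. comm_group (gr M n)"
    and "\<And>d n \<theta>. \<theta> \<in> steenrod_deg d \<Longrightarrow> act M d n \<theta> \<in> hom (gr M n) (gr M (n + d))"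
    and "\<And>d n \<theta> \<eta> x. \<theta> \<in> steenrod_deg d \<Longrightarrow> \<eta> \<in> steenrod_deg d \<Longrightarrow> x \<in> carrier (gr M n) \<Longrightarrow>
      act M d n (\<theta> \<oplus>\<^bsub>\<A>\<^esub> \<eta>) x = act M d n \<theta> x \<otimes>\<^bsub>gr M (n + d)\<^esub> act M d n \<eta> x"
    and "\<And>d e n \<theta> \<eta> x. \<theta> \<in> steenrod_deg d \<Longrightarrow> \<eta> \<in> steenrod_deg e \<Longrightarrow> x \<in> carrier (gr M n) \<Longrightarrow>
      act M (d + e) n (\<theta> \<otimes>\<^bsub>\<A>\<^esub> \<eta>) x = act M d (n + e) \<theta> (act M e n \<eta> x)"
    and "\<And>n x. x \<in> carrier (gr M n) \<Longrightarrow> act M 0 n \<one>\<^bsub>\<A>\<^esub> x = x"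
    and "\<And>n k x. x \<in> carrier (gr M n) \<Longrightarrow> n < k \<Longrightarrow> act M k n (Sq k) x = \<one>\<^bsub>gr M (n + k)\<^esub>"
  shows "unstable M"
  unfolding unstable_def steenrod_module_def
  by (intro conjI allI ballI impI) (fact assms)+

lemma Mor_hom: "f \<in> Mor M N \<Longrightarrow> f n \<in> hom (gr M n) (gr N n)"
  by (simp add: Mor_def)

lemma Mor_closed: "f \<in> Mor M N \<Longrightarrow> x \<in> carrier (gr M n) \<Longrightarrow> f n x \<in> carrier (gr N n)"
  using Mor_hom[of f M N n] by (auto simp: hom_def)

lemma Mor_act:
  "f \<in> Mor M N \<Longrightarrow> \<theta> \<in> steenrod_deg d \<Longrightarrow> x \<in> carrier (gr M n) \<Longrightarrow>
    f (n + d) (act M d n \<theta> x) = act N d n \<theta> (f n x)"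
  unfolding Mor_def by blast

lemma Mor_ext: "f \<in> Mor M N \<Longrightarrow> f n \<in> extensional (carrier (gr M n))"
  by (simp add: Mor_def)

lemma MorI:
  assumes "\<And>n. f n \<in> hom (gr M n) (gr N n)" "\<And>n. f n \<in> extensional (carrier (gr M n))"
    and "\<And>d n \<theta> x. \<theta> \<in> steenrod_deg d \<Longrightarrow> x \<in> carrier (gr M n) \<Longrightarrow>
      f (n + d) (act M d n \<theta> x) = act N d n \<theta> (f n x)"
  shows "f \<in> Mor M N"
  using assms by (simp add: Mor_def)

definition id_mor :: "'a gmodule \<Rightarrow> nat \<Rightarrow> 'a \<Rightarrow> 'a" where
  "id_mor M = (\<lambda>n. \<lambda>x\<in>carrier (gr M n). x)"

lemma restrict_hom: "monoid G \<Longrightarrow> f \<in> hom G H \<Longrightarrow> (\<lambda>x\<in>carrier G. f x) \<in> hom G H"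
  by (auto simp: hom_def monoid.m_closed)

lemma restrict_MorI:
  assumes "unstable M" "\<And>n. f n \<in> hom (gr M n) (gr N n)"
    and "\<And>d n \<theta> x. \<theta> \<in> steenrod_deg d \<Longrightarrow> x \<in> carrier (gr M n) \<Longrightarrow>
      f (n + d) (act M d n \<theta> x) = act N d n \<theta> (f n x)"
  shows "(\<lambda>n. \<lambda>x\<in>carrier (gr M n). f n x) \<in> Mor M N"
proof (rule MorI)
  have "monoid (gr M n)" for n using unstable_grp[OF assms(1)] by (simp add: group_def)
  then show "(\<lambda>x\<in>carrier (gr M n). f n x) \<in> hom (gr M n) (gr N n)" for n
    using assms(2) by (simp add: restrict_hom)
qed (use assms act_closed[OF assms(1)] in simp_all)

lemma id_mor_Mor: "unstable M \<Longrightarrow> id_mor M \<in> Mor M M"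
  unfolding id_mor_def by (rule restrict_MorI) (auto simp: hom_def)

lemma zero_mor_Mor:
  assumes "unstable M" "unstable N" shows "zero_mor M N \<in> Mor M N"
  unfolding zero_mor_def
  by (rule restrict_MorI[OF assms(1)])
    (auto simp: hom_def act_one[OF assms(2)] monoid.one_closed monoid.l_one group.is_monoid[OF unstable_grp[OF assms(2)]])

lemma comp_mor_eq: "comp_mor M g f = (\<lambda>n. \<lambda>x\<in>carrier (gr M n). g n (f n x))"
  by (simp add: comp_mor_def compose_def)

lemma comp_mor_id: "f \<in> Mor M N \<Longrightarrow> comp_mor M f (id_mor M) = f"
  by (rule ext, rule extensionalityI[OF _ Mor_ext]) (auto simp: comp_mor_eq id_mor_def extensional_def)

lemma id_comp_mor: "f \<in> Mor M N \<Longrightarrow> comp_mor M (id_mor N) f = f"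
  by (rule ext, rule extensionalityI[OF _ Mor_ext])
    (auto simp: comp_mor_eq id_mor_def Mor_closed extensional_def)

lemma unstable_submodule:
  assumes M: "unstable M"
    and S: "\<And>n. subgroup (S n) (gr M n)"
    and act: "\<And>d n \<theta> x. \<theta> \<in> steenrod_deg d \<Longrightarrow> x \<in> S n \<Longrightarrow> act M d n \<theta> x \<in> S (n + d)"
  shows "unstable (M\<lparr>gr := \<lambda>n. (gr M n)\<lparr>carrier := S n\<rparr>\<rparr>)"
proof -
  have sub: "x \<in> carrier (gr M n)" if "x \<in> S n" for x n
    using S[of n] that by (rule subgroup.mem_carrier)
  have grp: "comm_group ((gr M n)\<lparr>carrier := S n\<rparr>)" for n
  proof -
    interpret comm_group "gr M n" by (rule unstable_group[OF M])
    have "group ((gr M n)\<lparr>carrier := S n\<rparr>)" by (rule subgroup_imp_group[OF S])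
    then show ?thesis
      by (rule group.group_comm_groupI) (simp add: m_comm sub)
  qed
  show ?thesis
    by (rule unstableI)
      (use M sub act grp act_hom[OF M] in
        \<open>auto simp: act_add act_mult act_unit act_Sq_unstable hom_def\<close>)
qed

section \<open>Transport of structure along injections\<close>

text \<open>The structure of \<open>N\<close> carried over to the images of its components under the maps \<open>e n\<close>,
  which are injective wherever this is used.\<close>

definition copy_module :: "(nat \<Rightarrow> 'b \<Rightarrow> 'a) \<Rightarrow> 'b gmodule \<Rightarrow> 'a gmodule" where
  "copy_module e N = \<lparr>gr = (\<lambda>n. let i = inv_into (carrier (gr N n)) (e n) in
       \<lparr>carrier = e n ` carrier (gr N n),
        monoid.mult = (\<lambda>x y. e n (i x \<otimes>\<^bsub>gr N n\<^esub> i y)), one = e n \<one>\<^bsub>gr N n\<^esub>\<rparr>),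
     act = (\<lambda>d n \<theta> x. e (n + d) (act N d n \<theta> (inv_into (carrier (gr N n)) (e n) x)))\<rparr>"

lemma copy_module:
  fixes e :: "nat \<Rightarrow> 'b \<Rightarrow> 'a"
  assumes N: "unstable N" and e: "\<And>n. inj_on (e n) (carrier (gr N n))"
  shows "unstable (copy_module e N)"
    and "(\<lambda>n. \<lambda>x\<in>carrier (gr (copy_module e N) n). inv_into (carrier (gr N n)) (e n) x)
      \<in> Mor (copy_module e N) N"
proof -
  define i where "i n = inv_into (carrier (gr N n)) (e n)" for n
  have ie [simp]: "i n (e n x) = x" if "x \<in> carrier (gr N n)" for n x
    using e that by (simp add: i_def)
  note [simp] = act_closed[OF N] monoid.m_closed[OF group.is_monoid[OF unstable_grp[OF N]]]
    monoid.one_closed[OF group.is_monoid[OF unstable_grp[OF N]]]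
  have gr: "gr (copy_module e N) n = \<lparr>carrier = e n ` carrier (gr N n),
        monoid.mult = (\<lambda>x y. e n (i n x \<otimes>\<^bsub>gr N n\<^esub> i n y)), one = e n \<one>\<^bsub>gr N n\<^esub>\<rparr>" for n
    by (simp add: copy_module_def i_def Let_def)
  have act: "act (copy_module e N) d n \<theta> x = e (n + d) (act N d n \<theta> (i n x))" for d n \<theta> x
    by (simp add: copy_module_def i_def)
  show u: "unstable (copy_module e N)"
  proof (rule unstableI)
    fix n
    interpret comm_group "gr N n" by (rule unstable_group[OF N])
    show "comm_group (gr (copy_module e N) n)"
    proof (rule comm_groupI)
      fix x assume "x \<in> carrier (gr (copy_module e N) n)"
      then obtain a where a: "a \<in> carrier (gr N n)" "x = e n a" by (auto simp: gr)
      then show "\<exists>y\<in>carrier (gr (copy_module e N) n). y \<otimes>\<^bsub>gr (copy_module e N) n\<^esub> x = \<one>\<^bsub>gr (copy_module e N) n\<^esub>"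
        by (intro bexI[of _ "e n (inv\<^bsub>gr N n\<^esub> a)"]) (simp_all add: gr)
    qed (auto simp: gr m_ac)
  next
    fix d n \<theta> assume "\<theta> \<in> steenrod_deg d"
    with hom_mult[OF act_hom[OF N this]]
    show "act (copy_module e N) d n \<theta> \<in> hom (gr (copy_module e N) n) (gr (copy_module e N) (n + d))"
      by (auto simp: hom_def gr act)
  next
    fix d k n \<theta> \<eta> x
    assume *: "\<theta> \<in> steenrod_deg d" "\<eta> \<in> steenrod_deg k" "x \<in> carrier (gr (copy_module e N) n)"
    then show "act (copy_module e N) (d + k) n (\<theta> \<otimes>\<^bsub>\<A>\<^esub> \<eta>) x
        = act (copy_module e N) d (n + k) \<theta> (act (copy_module e N) k n \<eta> x)"
      using N by (auto simp: gr act act_mult) (simp add: ac_simps)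
  qed (use N in \<open>auto simp: gr act act_add act_unit act_Sq_unstable\<close>)
  have "(\<lambda>n. \<lambda>x\<in>carrier (gr (copy_module e N) n). i n x) \<in> Mor (copy_module e N) N"
    by (rule restrict_MorI[OF u]) (auto simp: hom_def gr act)
  then show "(\<lambda>n. \<lambda>x\<in>carrier (gr (copy_module e N) n). inv_into (carrier (gr N n)) (e n) x)
      \<in> Mor (copy_module e N) N"
    by (simp add: i_def)
qed

section \<open>Abstract and explicit representing objects\<close>

text \<open>The functional on the represented degree of \<open>J\<close> that corresponds to the identity of \<open>J\<close>.\<close>

definition universal :: "('a gmodule \<Rightarrow> (nat \<Rightarrow> 'a \<Rightarrow> 'a) \<Rightarrow> 'a \<Rightarrow> bit) \<Rightarrow> 'a gmodule \<Rightarrow> 'a \<Rightarrow> bit" where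
  "universal \<rho> J = \<rho> J (id_mor J)"

lemma representsD:
  assumes "represents n J \<rho>"
  shows "unstable J"
    and "unstable M \<Longrightarrow> bij_betw (\<rho> M) (Mor M J) (dual (gr M n))"
    and "unstable M \<Longrightarrow> unstable N \<Longrightarrow> h \<in> Mor M N \<Longrightarrow> f \<in> Mor N J \<Longrightarrow>
      \<rho> M (comp_mor M f h) = compose (carrier (gr M n)) (\<rho> N f) (h n)"
  using assms by (simp_all add: represents_def)

text \<open>The Yoneda lemma: the bijection is given by pulling back the universal element.\<close>

lemma represents_universal:
  assumes rep: "represents n J \<rho>" and M: "unstable M" and h: "h \<in> Mor M J"
  shows "\<rho> M h = compose (carrier (gr M n)) (universal \<rho> J) (h n)"
proof -
  note J = representsD(1)[OF rep]
  have "\<rho> M (comp_mor M (id_mor J) h) = compose (carrier (gr M n)) (\<rho> J (id_mor J)) (h n)"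
    by (rule representsD(3)[OF rep M J h id_mor_Mor[OF J]])
  then show ?thesis by (simp only: universal_def id_comp_mor[OF h])
qed

lemma universal_dual:
  assumes rep: "represents n J \<rho>" shows "universal \<rho> J \<in> dual (gr J n)"
  unfolding universal_def
  by (rule bij_betw_apply[OF representsD(2)[OF rep representsD(1)[OF rep]] id_mor_Mor[OF representsD(1)[OF rep]]])

lemma represents_inj:
  assumes "represents n J \<rho>" "unstable M" "f \<in> Mor M J" "g \<in> Mor M J" "\<rho> M f = \<rho> M g"
  shows "f = g"
  by (rule inj_onD[OF bij_betw_imp_inj_on[OF representsD(2)[OF assms(1,2)]] assms(5,3,4)])

lemma represents_surj:
  assumes "represents n J \<rho>" "unstable M" "\<psi> \<in> dual (gr M n)"
  obtains f where "f \<in> Mor M J" "\<rho> M f = \<psi>"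
proof -
  have "\<psi> \<in> \<rho> M ` Mor M J"
    unfolding bij_betw_imp_surj_on[OF representsD(2)[OF assms(1,2)]] by (rule assms(3))
  then show ?thesis by (auto intro: that)
qed

lemma comp_zero_mor:
  assumes "f \<in> Mor N P" "unstable N" "unstable P"
  shows "comp_mor M f (zero_mor M N) = zero_mor M P"
  using hom_one[OF Mor_hom[OF assms(1)] unstable_grp[OF assms(2)] unstable_grp[OF assms(3)]]
  by (auto simp: comp_mor_eq zero_mor_def fun_eq_iff)

text \<open>\<open>\<alpha>\<close> is an isomorphism from \<open>J\<close> to the explicit Brown-Gitler module under which evaluation at
  the unit of the Steenrod algebra corresponds to the functional \<open>u\<close>.\<close>

definition realizes :: "nat \<Rightarrow> 'a gmodule \<Rightarrow> ('a \<Rightarrow> bit) \<Rightarrow> (nat \<Rightarrow> 'a \<Rightarrow> free_sq set \<Rightarrow> bit) \<Rightarrow> bool" where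
  "realizes n J u \<alpha> \<longleftrightarrow> unstable J \<and> \<alpha> \<in> Mor J (bg_module n) \<and>
     (\<forall>m. bij_betw (\<alpha> m) (carrier (gr J m)) (bg_carrier n m)) \<and>
     (\<forall>x\<in>carrier (gr J n). \<alpha> n x \<one>\<^bsub>\<A>\<^esub> = u x)"

lemma carrier_bg_module [simp]: "carrier (gr (bg_module n) m) = bg_carrier n m"
  by (simp add: bg_module_def)

text \<open>\<open>\<alpha>\<close> corresponds to the universal element of \<open>J\<close>, so composition with \<open>\<alpha>\<close> is a bijection on
  morphisms from every test module with elements in \<open>'a\<close>. Injectivity follows by testing on the
  kernel of \<open>\<alpha>\<close>, whose inclusion and zero map have the same composite with \<open>\<alpha>\<close>; surjectivity by
  testing on a copy of the explicit module, whose identification with it must factor through \<open>\<alpha>\<close>.\<close>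

lemma represents_realizes:
  fixes J :: "'a gmodule"
  assumes inf: "infinite (UNIV :: 'a set)" and rep: "represents n J \<rho>"
  obtains \<alpha> where "realizes n J (universal \<rho> J) \<alpha>"
proof -
  note J = representsD(1)[OF rep]
  have bg: "represents n (bg_module n) (bg_rep n :: 'a gmodule \<Rightarrow> _)" by (rule bg_module_represents)
  note B = bg_module_unstable[of n]
  obtain \<alpha> where \<alpha>: "\<alpha> \<in> Mor J (bg_module n)" "bg_rep n J \<alpha> = universal \<rho> J"
    by (rule represents_surj[OF bg J universal_dual[OF rep]])
  have comp: "bg_rep n M (comp_mor M \<alpha> h) = \<rho> M h" if M: "unstable M" and h: "h \<in> Mor M J" for M :: "'a gmodule" and h
    using representsD(3)[OF bg M J h \<alpha>(1)] represents_universal[OF rep M h] by (simp only: \<alpha>(2))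
  have "inj_on (\<alpha> m) (carrier (gr J m))" for m
  proof -
    define S where "S k = kernel (gr J k) (gr (bg_module n) k) (\<alpha> k)" for k
    interpret \<alpha>: group_hom "gr J k" "gr (bg_module n) k" "\<alpha> k" for k
      using unstable_grp[OF J] unstable_grp[OF B] Mor_hom[OF \<alpha>(1)]
      by (simp add: group_hom_def group_hom_axioms_def)
    define K where "K = J\<lparr>gr := \<lambda>n. (gr J n)\<lparr>carrier := S n\<rparr>\<rparr>"
    have grK: "gr K k = (gr J k)\<lparr>carrier := S k\<rparr>" "act K = act J" for k by (simp_all add: K_def)
    have S: "x \<in> carrier (gr J k)" "\<alpha> k x = \<one>\<^bsub>gr (bg_module n) k\<^esub>" if "x \<in> S k" for x k
      using that by (simp_all add: S_def kernel_def)
    have K: "unstable K"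
      unfolding K_def
    proof (rule unstable_submodule[OF J])
      show "subgroup (S k) (gr J k)" for k unfolding S_def by (rule \<alpha>.subgroup_kernel)
      show "act J d k \<theta> x \<in> S (k + d)" if \<theta>: "\<theta> \<in> steenrod_deg d" and x: "x \<in> S k" for d k \<theta> x
        using S[OF x] act_closed[OF J \<theta>] Mor_act[OF \<alpha>(1) \<theta>] act_one[OF B \<theta>]
        by (simp add: S_def kernel_def)
    qed
    define \<iota> where "\<iota> = (\<lambda>k. \<lambda>x\<in>carrier (gr K k). x)"
    have \<iota>: "\<iota> \<in> Mor K J"
      unfolding \<iota>_def by (rule restrict_MorI[OF K]) (auto simp: hom_def grK S)
    have z: "zero_mor K J \<in> Mor K J" by (rule zero_mor_Mor[OF K J])
    have "comp_mor K \<alpha> \<iota> = zero_mor K (bg_module n)"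
      by (auto simp: comp_mor_eq zero_mor_def \<iota>_def grK S fun_eq_iff)
    then have "comp_mor K \<alpha> \<iota> = comp_mor K \<alpha> (zero_mor K J)"
      by (simp only: comp_zero_mor[OF \<alpha>(1) J B])
    then have "\<rho> K \<iota> = \<rho> K (zero_mor K J)"
      using comp[OF K \<iota>] comp[OF K z] by simp
    then have eq: "\<iota> = zero_mor K J" by (rule represents_inj[OF rep K \<iota> z])
    have "x = \<one>\<^bsub>gr J m\<^esub>" if "x \<in> S m" for x
    proof -
      have "\<iota> m x = zero_mor K J m x" by (simp only: eq)
      then show ?thesis using that by (simp add: \<iota>_def zero_mor_def grK)
    qed
    moreover have "\<one>\<^bsub>gr J m\<^esub> \<in> S m"
      unfolding S_def by (rule subgroup.one_closed[OF \<alpha>.subgroup_kernel])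
    ultimately have "S m = {\<one>\<^bsub>gr J m\<^esub>}" by blast
    then show ?thesis unfolding S_def by (rule \<alpha>.trivial_ker_imp_inj)
  qed
  moreover have "\<alpha> m ` carrier (gr J m) = bg_carrier n m" for m
  proof (intro equalityI subsetI)
    fix \<phi> assume "\<phi> \<in> \<alpha> m ` carrier (gr J m)"
    then show "\<phi> \<in> bg_carrier n m" using Mor_closed[OF \<alpha>(1)] by auto
  next
    have "\<exists>f :: (free_sq set \<Rightarrow> bit) \<Rightarrow> 'a. inj_on f (bg_carrier n k)" for k
    proof -
      obtain A :: "'a set" where "finite A" "card A = card (bg_carrier n k)"
        using infinite_arbitrarily_large[OF inf] by blast
      then show ?thesis using card_le_inj[OF finite_bg_carrier, of A n k] by auto
    qed
    then obtain e :: "nat \<Rightarrow> (free_sq set \<Rightarrow> bit) \<Rightarrow> 'a" where e: "\<And>k. inj_on (e k) (bg_carrier n k)"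
      by metis
    define C where "C = copy_module e (bg_module n)"
    define d where "d = (\<lambda>k. \<lambda>x\<in>carrier (gr C k). inv_into (carrier (gr (bg_module n) k)) (e k) x)"
    have C: "unstable C" and d: "d \<in> Mor C (bg_module n)"
      unfolding C_def d_def by (rule copy_module[OF B]; simp add: e)+
    have "bg_rep n C d \<in> dual (gr C n)"
      by (rule bij_betw_apply[OF representsD(2)[OF bg C] d])
    then obtain h where h: "h \<in> Mor C J" "\<rho> C h = bg_rep n C d"
      by (rule represents_surj[OF rep C])
    have cM: "comp_mor C \<alpha> h \<in> Mor C (bg_module n)"
      unfolding comp_mor_eq
    proof (rule restrict_MorI[OF C])
      show "(\<lambda>x. \<alpha> k (h k x)) \<in> hom (gr C k) (gr (bg_module n) k)" for k
        using hom_compose[OF Mor_hom[OF h(1)] Mor_hom[OF \<alpha>(1)], of k] by (simp add: comp_def)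
    qed (simp add: Mor_act[OF h(1)] Mor_act[OF \<alpha>(1)] Mor_closed[OF h(1)])
    have "bg_rep n C (comp_mor C \<alpha> h) = bg_rep n C d"
      using comp[OF C h(1)] h(2) by simp
    then have eq: "comp_mor C \<alpha> h = d" by (rule represents_inj[OF bg C cM d])
    fix \<phi> assume \<phi>: "\<phi> \<in> bg_carrier n m"
    then have c: "e m \<phi> \<in> carrier (gr C m)" by (simp add: C_def copy_module_def Let_def)
    have "comp_mor C \<alpha> h m (e m \<phi>) = d m (e m \<phi>)" by (simp only: eq)
    then have "\<alpha> m (h m (e m \<phi>)) = \<phi>" using c \<phi> e by (simp add: comp_mor_eq d_def)
    then show "\<phi> \<in> \<alpha> m ` carrier (gr J m)" using Mor_closed[OF h(1) c] by (metis imageI)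
  qed
  moreover have "\<alpha> n x \<one>\<^bsub>\<A>\<^esub> = universal \<rho> J x" if "x \<in> carrier (gr J n)" for x
    using that by (simp add: bg_rep_def flip: \<alpha>(2))
  ultimately have "realizes n J (universal \<rho> J) \<alpha>"
    using J \<alpha>(1) by (simp add: realizes_def bij_betw_def)
  then show ?thesis by (rule that)
qed

lemma realizesD:
  assumes "realizes n J u \<alpha>"
  shows "unstable J" "\<alpha> \<in> Mor J (bg_module n)" "bij_betw (\<alpha> m) (carrier (gr J m)) (bg_carrier n m)"
    "x \<in> carrier (gr J n) \<Longrightarrow> \<alpha> n x \<one>\<^bsub>\<A>\<^esub> = u x"
  using assms by (simp_all add: realizes_def)

lemma realizes_closed: "realizes n J u \<alpha> \<Longrightarrow> x \<in> carrier (gr J m) \<Longrightarrow> \<alpha> m x \<in> bg_carrier n m"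
  using Mor_closed[OF realizesD(2)] by fastforce

text \<open>Commutation with \<open>\<theta>\<close> turns the value of \<open>\<alpha> m x\<close> at \<open>\<theta>\<close> into the value of \<open>\<alpha> n (\<theta> x)\<close> at the
  unit.\<close>

lemma realizes_eval:
  assumes r: "realizes n J u \<alpha>" and "m \<le> n" "x \<in> carrier (gr J m)" "\<theta> \<in> bg_dom n m"
  shows "\<alpha> m x \<theta> = u (act J (n - m) m \<theta> x)"
proof -
  have \<theta>: "\<theta> \<in> steenrod_deg (n - m)" and n: "m + (n - m) = n" using assms by (simp_all add: bg_dom_def)
  have "act J (n - m) m \<theta> x \<in> carrier (gr J n)"
    using act_closed[OF realizesD(1)[OF r] \<theta> assms(3)] n by simp
  then have "u (act J (n - m) m \<theta> x) = \<alpha> n (act J (n - m) m \<theta> x) \<one>\<^bsub>\<A>\<^esub>"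
    using realizesD(4)[OF r] by simp
  also have "\<dots> = act (bg_module n) (n - m) m \<theta> (\<alpha> m x) \<one>\<^bsub>\<A>\<^esub>"
    using Mor_act[OF realizesD(2)[OF r] \<theta> assms(3)] n by simp
  also have "\<dots> = \<alpha> m x \<theta>"
    using n bg_dom_one[of n] assms(4) by (simp add: bg_module_def bg_dom_carr)
  finally show ?thesis ..
qed

text \<open>The morphism \<open>\<bullet>\<theta>\<close> exists by representability of \<open>J m\<close> applied to the functional \<open>x \<mapsto> u (\<theta>
  x)\<close> on \<open>J n\<close>, where \<open>u\<close> is the universal element of \<open>J n\<close>. It is unique because testing with the
  identity of \<open>J n\<close> recovers it. Thus the definite description is well defined.\<close>

lemma bullet_characterization:
  fixes J :: "nat \<Rightarrow> 'a gmodule"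
  assumes rep: "\<And>p. represents p (J p) (\<rho> p)" and le: "m \<le> n" and \<theta>: "\<theta> \<in> steenrod_deg (n - m)"
  shows "bullet J \<rho> n m \<theta> \<in> Mor (J n) (J m)"
    and "x \<in> carrier (gr (J n) m) \<Longrightarrow>
      universal (\<rho> m) (J m) (bullet J \<rho> n m \<theta> m x) = universal (\<rho> n) (J n) (act (J n) (n - m) m \<theta> x)"
proof -
  define u where "u p = universal (\<rho> p) (J p)" for p
  note J = representsD(1)[OF rep]
  have n: "m + (n - m) = n" using le by simp
  define \<psi> where "\<psi> = (\<lambda>x\<in>carrier (gr (J n) m). u n (act (J n) (n - m) m \<theta> x))"
  have un: "u n \<in> hom (gr (J n) n) F2" using universal_dual[OF rep[of n]] by (simp add: dual_def u_def)
  have "act (J n) (n - m) m \<theta> \<in> hom (gr (J n) m) (gr (J n) n)"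
    using act_hom[OF J[of n] \<theta>, of m] n by simp
  from hom_compose[OF this un] have "(\<lambda>x. u n (act (J n) (n - m) m \<theta> x)) \<in> hom (gr (J n) m) F2"
    by (simp add: comp_def)
  from restrict_hom[OF group.is_monoid[OF unstable_grp[OF J[of n]]] this]
  have "\<psi> \<in> dual (gr (J n) m)" by (simp add: \<psi>_def dual_def)
  then obtain f where f: "f \<in> Mor (J n) (J m)" "\<rho> m (J n) f = \<psi>"
    by (rule represents_surj[OF rep J])
  define P where "P g \<longleftrightarrow> g \<in> Mor (J n) (J m) \<and>
     (\<forall>M. unstable M \<longrightarrow> (\<forall>h \<in> Mor M (J n).
        \<rho> m M (comp_mor M g h) = compose (carrier (gr M m)) (\<rho> n M h) (act M (n - m) m \<theta>)))" for g
  have "\<rho> m M (comp_mor M f h) = compose (carrier (gr M m)) (\<rho> n M h) (act M (n - m) m \<theta>)"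
    if M: "unstable M" and h: "h \<in> Mor M (J n)" for M h
  proof -
    have "\<rho> m M (comp_mor M f h) x = compose (carrier (gr M m)) (\<rho> n M h) (act M (n - m) m \<theta>) x" for x
    proof (cases "x \<in> carrier (gr M m)")
      case True
      have "act M (n - m) m \<theta> x \<in> carrier (gr M n)"
        using act_closed[OF M \<theta> True] n by simp
      moreover have "h n (act M (n - m) m \<theta> x) = act (J n) (n - m) m \<theta> (h m x)"
        using Mor_act[OF h \<theta> True] n by simp
      ultimately show ?thesis
        using True Mor_closed[OF h True]
        by (simp add: representsD(3)[OF rep M J h f(1)] represents_universal[OF rep M h] f(2)
          compose_def \<psi>_def u_def)
    next
      case False
      then show ?thesis by (simp add: representsD(3)[OF rep M J h f(1)] compose_def)
    qed
    then show ?thesis by (rule ext)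
  qed
  then have Pf: "P f" using f(1) unfolding P_def by blast
  have "g = f" if "P g" for g
  proof (rule represents_inj[OF rep J[of n]])
    show "g \<in> Mor (J n) (J m)" "f \<in> Mor (J n) (J m)" using that f(1) unfolding P_def by blast+
    have "\<rho> m (J n) (comp_mor (J n) g (id_mor (J n))) = \<rho> m (J n) (comp_mor (J n) f (id_mor (J n)))"
      using that Pf id_mor_Mor[OF J[of n]] J[of n] unfolding P_def by simp
    then show "\<rho> m (J n) g = \<rho> m (J n) f"
      using comp_mor_id[OF \<open>g \<in> Mor (J n) (J m)\<close>] comp_mor_id[OF f(1)] by simp
  qed
  then have bf: "bullet J \<rho> n m \<theta> = f"
    unfolding bullet_def P_def[symmetric] using Pf by blast
  show "bullet J \<rho> n m \<theta> \<in> Mor (J n) (J m)" using f(1) by (simp add: bf)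
  show "universal (\<rho> m) (J m) (bullet J \<rho> n m \<theta> m x) = universal (\<rho> n) (J n) (act (J n) (n - m) m \<theta> x)"
    if x: "x \<in> carrier (gr (J n) m)"
  proof -
    have "\<rho> m (J n) f x = \<psi> x" by (simp add: f(2))
    then show ?thesis
      using x by (simp add: represents_universal[OF rep J f(1)] compose_def \<psi>_def bf u_def)
  qed
qed

text \<open>Under the identification with functionals, \<open>\<bullet>\<theta>\<close> is precomposition with left multiplication
  by \<open>\<theta>\<close>.\<close>

lemma bullet_realized:
  fixes J :: "nat \<Rightarrow> 'a gmodule"
  assumes rep: "\<And>p. represents p (J p) (\<rho> p)" and le: "m \<le> n" and \<theta>: "\<theta> \<in> steenrod_deg (n - m)"
    and \<alpha>: "\<And>p. realizes p (J p) (universal (\<rho> p) (J p)) (\<alpha> p)"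
    and x: "x \<in> carrier (gr (J n) k)" and \<eta>: "\<eta> \<in> bg_dom m k"
  shows "\<alpha> m k (bullet J \<rho> n m \<theta> k x) \<eta> = \<alpha> n k x (\<theta> \<otimes>\<^bsub>\<A>\<^esub> \<eta>)"
proof -
  let ?f = "bullet J \<rho> n m \<theta>"
  note J = realizesD(1)[OF \<alpha>]
  note f = bullet_characterization[OF rep le \<theta>]
  have fx: "?f k x \<in> carrier (gr (J m) k)" by (rule Mor_closed[OF f(1) x])
  show ?thesis
  proof (cases "k \<le> m")
    case True
    have \<eta>': "\<eta> \<in> steenrod_deg (m - k)" and k: "k + (m - k) = m" "k + (n - k) = n" "n - m + (m - k) = n - k"
      using \<eta> True le by (simp_all add: bg_dom_def)
    have "\<alpha> m k (?f k x) \<eta> = universal (\<rho> m) (J m) (act (J m) (m - k) k \<eta> (?f k x))"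
      by (rule realizes_eval[OF \<alpha> True fx \<eta>])
    also have "act (J m) (m - k) k \<eta> (?f k x) = ?f m (act (J n) (m - k) k \<eta> x)"
      using Mor_act[OF f(1) \<eta>' x] k by simp
    also have "universal (\<rho> m) (J m) \<dots> = universal (\<rho> n) (J n) (act (J n) (n - m) m \<theta> (act (J n) (m - k) k \<eta> x))"
      using act_closed[OF J \<eta>' x] k by (intro f(2)) simp
    also have "act (J n) (n - m) m \<theta> (act (J n) (m - k) k \<eta> x) = act (J n) (n - k) k (\<theta> \<otimes>\<^bsub>\<A>\<^esub> \<eta>) x"
      using act_mult[OF J \<theta> \<eta>' x] k by simp
    also have "universal (\<rho> n) (J n) \<dots> = \<alpha> n k x (\<theta> \<otimes>\<^bsub>\<A>\<^esub> \<eta>)"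
      using True le by (intro realizes_eval[OF \<alpha> _ x bg_dom_mult_left[OF \<theta> le \<eta>], symmetric]) simp
    finally show ?thesis .
  next
    case False
    then have "\<eta> = \<zero>\<^bsub>\<A>\<^esub>" using \<eta> by (simp add: bg_dom_def)
    then show ?thesis
      using bg_carrier_zero[OF realizes_closed[OF \<alpha> fx]] bg_carrier_zero[OF realizes_closed[OF \<alpha> x]] \<theta>
      by (simp add: steenrod_deg_closed)
  qed
qed

section \<open>Zero modules, direct sums and matrices\<close>

lemma unstable_zero_module: "unstable (zero_module :: 'a gmodule)"
proof (rule unstableI)
  show "comm_group (gr (zero_module :: 'a gmodule) n)" for n
    by (rule comm_groupI) (simp_all add: zero_module_def singleton_group_def)
qed (auto simp: zero_module_def singleton_group_def hom_def)

lemma dsum_simps [simp]: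
  "carrier (gr (dsum M N) n) = carrier (gr M n) \<times> carrier (gr N n)"
  "(x, y) \<otimes>\<^bsub>gr (dsum M N) n\<^esub> (x', y') = (x \<otimes>\<^bsub>gr M n\<^esub> x', y \<otimes>\<^bsub>gr N n\<^esub> y')"
  "\<one>\<^bsub>gr (dsum M N) n\<^esub> = (\<one>\<^bsub>gr M n\<^esub>, \<one>\<^bsub>gr N n\<^esub>)"
  "act (dsum M N) d n \<theta> (x, y) = (act M d n \<theta> x, act N d n \<theta> y)"
  by (simp_all add: dsum_def DirProd_def)

lemma unstable_dsum:
  assumes M: "unstable M" and N: "unstable N"
  shows "unstable (dsum M N)"
proof (rule unstableI)
  fix n
  interpret M: comm_group "gr M n" by (rule unstable_group[OF M])
  interpret N: comm_group "gr N n" by (rule unstable_group[OF N])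
  show "comm_group (gr (dsum M N) n)"
  proof (rule comm_groupI)
    fix p assume "p \<in> carrier (gr (dsum M N) n)"
    then show "\<exists>q\<in>carrier (gr (dsum M N) n). q \<otimes>\<^bsub>gr (dsum M N) n\<^esub> p = \<one>\<^bsub>gr (dsum M N) n\<^esub>"
      by (intro bexI[of _ "(inv\<^bsub>gr M n\<^esub> fst p, inv\<^bsub>gr N n\<^esub> snd p)"]) auto
  qed (auto simp: M.m_ac N.m_ac)
next
  fix d n \<theta> assume \<theta>: "\<theta> \<in> steenrod_deg d"
  show "act (dsum M N) d n \<theta> \<in> hom (gr (dsum M N) n) (gr (dsum M N) (n + d))"
    using act_hom[OF M \<theta>, of n] act_hom[OF N \<theta>, of n] by (auto simp: hom_def)
qed (use M N in \<open>auto simp: act_add act_mult act_unit act_Sq_unstable\<close>)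

lemma matrix_mor_Mor:
  assumes M: "unstable M" "unstable M'" and N: "unstable N" "unstable N'"
    and a: "a \<in> Mor M N" and b: "b \<in> Mor M' N" and c: "c \<in> Mor M N'" and e: "e \<in> Mor M' N'"
  shows "matrix_mor M M' N N' a b c e \<in> Mor (dsum M M') (dsum N N')"
proof -
  have row: "(\<lambda>(x, y). f n x \<otimes>\<^bsub>gr P n\<^esub> g n y) \<in> hom (gr (dsum M M') n) (gr P n)"
    if P: "unstable P" and f: "f \<in> Mor M P" and g: "g \<in> Mor M' P" for f g n and P :: "'z gmodule"
  proof -
    interpret comm_group "gr P n" by (rule unstable_group[OF P])
    show ?thesis
      using Mor_hom[OF f, of n] Mor_hom[OF g, of n] by (auto simp: hom_def Pi_iff m_ac)
  qed
  have act: "act P d n \<theta> (f n x \<otimes>\<^bsub>gr P n\<^esub> g n y) = f (n + d) (act M d n \<theta> x) \<otimes>\<^bsub>gr P (n + d)\<^esub> g (n + d) (act M' d n \<theta> y)"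
    if "unstable P" "f \<in> Mor M P" "g \<in> Mor M' P" "\<theta> \<in> steenrod_deg d" "x \<in> carrier (gr M n)" "y \<in> carrier (gr M' n)"
    for f g n d \<theta> x y and P :: "'z gmodule"
    using that by (simp add: hom_mult[OF act_hom] Mor_act Mor_closed)
  show ?thesis
    unfolding matrix_mor_def
  proof (rule restrict_MorI[OF unstable_dsum[OF M]])
    show "(\<lambda>(x, y). (a n x \<otimes>\<^bsub>gr N n\<^esub> b n y, c n x \<otimes>\<^bsub>gr N' n\<^esub> e n y)) \<in> hom (gr (dsum M M') n) (gr (dsum N N') n)" for n
      using row[OF N(1) a b, of n] row[OF N(2) c e, of n] by (auto simp: hom_def Pi_iff)
  qed (auto simp: act N a b c e)
qed

section \<open>The sequence of Brown-Gitler modules\<close>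

locale realized_family =
  fixes J :: "nat \<Rightarrow> 'a gmodule"
    and \<rho> :: "nat \<Rightarrow> 'a gmodule \<Rightarrow> (nat \<Rightarrow> 'a \<Rightarrow> 'a) \<Rightarrow> 'a \<Rightarrow> bit"
    and \<alpha> :: "nat \<Rightarrow> nat \<Rightarrow> 'a \<Rightarrow> free_sq set \<Rightarrow> bit"
  assumes rep: "represents p (J p) (\<rho> p)"
    and real: "realizes p (J p) (universal (\<rho> p) (J p)) (\<alpha> p)"
begin

lemmas J_unstable = realizesD(1)[OF real]
lemmas \<alpha>_Mor = realizesD(2)[OF real]
lemmas \<alpha>_bij = realizesD(3)[OF real]
lemmas \<alpha>_closed = realizes_closed[OF real]

lemma \<alpha>_one: "\<eta> \<in> bg_dom p k \<Longrightarrow> \<alpha> p k \<one>\<^bsub>gr (J p) k\<^esub> \<eta> = 0"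
  using hom_one[OF Mor_hom[OF \<alpha>_Mor[of p], of k] unstable_grp[OF J_unstable] unstable_grp[OF bg_module_unstable]]
  by (simp add: bg_module_def)

lemma \<alpha>_eqI:
  assumes "x \<in> carrier (gr (J p) k)" "y \<in> carrier (gr (J p) k)" "\<And>\<eta>. \<eta> \<in> bg_dom p k \<Longrightarrow> \<alpha> p k x \<eta> = \<alpha> p k y \<eta>"
  shows "x = y"
proof -
  have "\<alpha> p k x = \<alpha> p k y"
    by (rule extensionalityI[OF bg_carrier_extensional bg_carrier_extensional])
      (use assms \<alpha>_closed in blast)+
  then show ?thesis using inj_onD[OF bij_betw_imp_inj_on[OF \<alpha>_bij[of p k]]] assms(1,2) by blast
qed

lemma bullet_eq_iff:
  assumes "m \<le> p" "\<theta> \<in> steenrod_deg (p - m)" "x \<in> carrier (gr (J p) k)" "y \<in> carrier (gr (J m) k)"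
  shows "bullet J \<rho> p m \<theta> k x = y \<longleftrightarrow> (\<forall>\<eta>\<in>bg_dom m k. \<alpha> p k x (\<theta> \<otimes>\<^bsub>\<A>\<^esub> \<eta>) = \<alpha> m k y \<eta>)"
proof -
  have v: "\<alpha> m k (bullet J \<rho> p m \<theta> k x) \<eta> = \<alpha> p k x (\<theta> \<otimes>\<^bsub>\<A>\<^esub> \<eta>)" if "\<eta> \<in> bg_dom m k" for \<eta>
    by (rule bullet_realized[OF rep assms(1,2) real assms(3) that])
  have "bullet J \<rho> p m \<theta> k x \<in> carrier (gr (J m) k)"
    by (rule Mor_closed[OF bullet_characterization(1)[OF rep assms(1,2)] assms(3)])
  from \<alpha>_eqI[OF this assms(4)] show ?thesis using v by auto
qed

lemma Sq_1_Mor: "bullet J \<rho> (p + 1) p (Sq 1) \<in> Mor (J (p + 1)) (J p)"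
  by (rule bullet_characterization(1)[OF rep]) (simp_all add: steenrod_deg_Sq)

lemma scriptJ_cases:
  obtains (some) q where "p + 1 = 4 * q" "scriptJ J p = J (2 * q)" "bullet_half J \<rho> p = bullet J \<rho> (p + 1) (2 * q) (Sq (2 * q))"
  | (none) "\<And>q. p + 1 \<noteq> 4 * q" "scriptJ J p = zero_module" "bullet_half J \<rho> p = zero_mor (J (p + 1)) (scriptJ J p)"
proof (cases "\<exists>q. p + 1 = 4 * q")
  case True
  then obtain q where q: "p + 1 = 4 * q" by blast
  have the: "(THE k. p + 1 = 4 * k) = q" unfolding q by (rule the_equality) auto
  have "Sq_half (p + 1) = Sq (2 * q)" unfolding q by (simp add: Sq_half_def)
  then show ?thesis
    using True by (intro some[OF q]) (simp_all only: scriptJ_def bullet_half_def the if_True)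
next
  case False
  then show ?thesis by (intro none) (auto simp: scriptJ_def bullet_half_def)
qed

lemma scriptJ_unstable: "unstable (scriptJ J p)"
  by (cases rule: scriptJ_cases[of p]) (simp_all add: J_unstable unstable_zero_module)

lemma bullet_half_Mor: "bullet_half J \<rho> p \<in> Mor (J (p + 1)) (scriptJ J p)"
proof (cases rule: scriptJ_cases[of p])
  case (some q)
  have "Sq (2 * q) \<in> steenrod_deg (p + 1 - 2 * q)" using some(1) steenrod_deg_Sq[of "2 * q"] by simp
  then show ?thesis
    unfolding some(2,3) using some(1) by (intro bullet_characterization(1)[OF rep]) simp_all
next
  case none
  show ?thesis unfolding none(3) by (rule zero_mor_Mor[OF J_unstable scriptJ_unstable])
qed

text \<open>When the target is the zero module, the equation holds trivially and so does the right-hand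
  side: no \<open>q\<close> satisfies \<open>p + 1 = 4 q\<close>.\<close>

lemma bullet_half_eq_iff:
  assumes x: "x \<in> carrier (gr (J (p + 1)) k)" and y: "y \<in> carrier (gr (scriptJ J p) k)"
  shows "bullet_half J \<rho> p k x = y \<longleftrightarrow>
    (\<forall>q. p + 1 = 4 * q \<longrightarrow> (\<forall>\<eta>\<in>bg_dom (2 * q) k. \<alpha> (p + 1) k x (Sq (2 * q) \<otimes>\<^bsub>\<A>\<^esub> \<eta>) = \<alpha> (2 * q) k y \<eta>))"
proof (cases rule: scriptJ_cases[of p])
  case (some q)
  have "Sq (2 * q) \<in> steenrod_deg (p + 1 - 2 * q)" using some(1) steenrod_deg_Sq[of "2 * q"] by simp
  then have "bullet_half J \<rho> p k x = y \<longleftrightarrow>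
      (\<forall>\<eta>\<in>bg_dom (2 * q) k. \<alpha> (p + 1) k x (Sq (2 * q) \<otimes>\<^bsub>\<A>\<^esub> \<eta>) = \<alpha> (2 * q) k y \<eta>)"
    using x y some(1) unfolding some(2,3) by (intro bullet_eq_iff) simp_all
  then show ?thesis using some(1) by auto
next
  case none
  have "bullet_half J \<rho> p k x = y"
    using x y unfolding none(3) none(2) by (simp add: zero_mor_def zero_module_def singleton_group_def)
  then show ?thesis using none(1) by blast
qed

lemma bg_sum_unstable: "unstable (bg_sum J p)"
  unfolding bg_sum_def by (rule unstable_dsum[OF J_unstable scriptJ_unstable])

lemma bg_map_Mor: "bg_map J \<rho> p \<in> Mor (bg_sum J (p + 1)) (bg_sum J p)"
  unfolding bg_map_def bg_sum_def
  by (intro matrix_mor_Mor J_unstable scriptJ_unstable Sq_1_Mor bullet_half_Mor zero_mor_Mor)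

lemma bg_map_eq_iff:
  assumes x: "x \<in> carrier (gr (J (p + 1)) k)" and y: "y \<in> carrier (gr (scriptJ J (p + 1)) k)"
    and z: "z \<in> carrier (gr (J p) k)" and w: "w \<in> carrier (gr (scriptJ J p) k)"
  shows "bg_map J \<rho> p k (x, y) = (z, w) \<longleftrightarrow>
    (\<forall>\<eta>\<in>bg_dom p k. \<alpha> (p + 1) k x (Sq 1 \<otimes>\<^bsub>\<A>\<^esub> \<eta>) = \<alpha> p k z \<eta>) \<and>
    (\<forall>q. p + 1 = 4 * q \<longrightarrow> (\<forall>\<eta>\<in>bg_dom (2 * q) k. \<alpha> (p + 1) k x (Sq (2 * q) \<otimes>\<^bsub>\<A>\<^esub> \<eta>) = \<alpha> (2 * q) k w \<eta>))"
proof -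
  have "bg_map J \<rho> p k (x, y) = (bullet J \<rho> (p + 1) p (Sq 1) k x, bullet_half J \<rho> p k x)"
    using x y Mor_closed[OF Sq_1_Mor x] Mor_closed[OF bullet_half_Mor x]
    by (simp add: bg_map_def matrix_mor_def zero_mor_def
      monoid.r_one[OF group.is_monoid[OF unstable_grp[OF J_unstable]]]
      monoid.r_one[OF group.is_monoid[OF unstable_grp[OF scriptJ_unstable]]])
  moreover have "Sq 1 \<in> steenrod_deg (p + 1 - p)" using steenrod_deg_Sq[of 1] by simp
  ultimately show ?thesis
    using bullet_eq_iff[OF _ _ x z, of "Sq 1"] bullet_half_eq_iff[OF x w] by simp
qed

lemma bg_map_bg_map:
  assumes "p \<in> carrier (gr (bg_sum J (n + 2)) k)"
  shows "bg_map J \<rho> n k (bg_map J \<rho> (n + 1) k p) = \<one>\<^bsub>gr (bg_sum J n) k\<^esub>"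
proof -
  have n: "n + 1 + 1 = n + 2" by simp
  obtain z w where p: "p = (z, w)" by (cases p)
  have zw: "z \<in> carrier (gr (J (n + 2)) k)" "w \<in> carrier (gr (scriptJ J (n + 2)) k)"
    using assms by (simp_all add: p bg_sum_def)
  obtain x y where xy: "bg_map J \<rho> (n + 1) k (z, w) = (x, y)" by fastforce
  have "(x, y) \<in> carrier (gr (bg_sum J (n + 1)) k)"
    using Mor_closed[OF bg_map_Mor[of "n + 1"], unfolded n, OF assms] unfolding p xy .
  then have xy': "x \<in> carrier (gr (J (n + 1)) k)" "y \<in> carrier (gr (scriptJ J (n + 1)) k)"
    by (simp_all add: bg_sum_def)
  have x: "\<alpha> (n + 1) k x \<eta> = \<alpha> (n + 2) k z (Sq 1 \<otimes>\<^bsub>\<A>\<^esub> \<eta>)" if "\<eta> \<in> bg_dom (n + 1) k" for \<eta>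
    using xy bg_map_eq_iff[of z "n + 1" k w x y, unfolded n, OF zw xy'] that by simp
  have one: "\<one>\<^bsub>gr M k\<^esub> \<in> carrier (gr M k)" if "unstable M" for M :: "'a gmodule"
    using monoid.one_closed[OF group.is_monoid[OF unstable_grp[OF that]]] .
  have "bg_map J \<rho> n k (x, y) = (\<one>\<^bsub>gr (J n) k\<^esub>, \<one>\<^bsub>gr (scriptJ J n) k\<^esub>)"
    unfolding bg_map_eq_iff[OF xy' one[OF J_unstable] one[OF scriptJ_unstable]]
  proof (intro conjI ballI allI impI)
    fix \<eta> assume \<eta>: "\<eta> \<in> bg_dom n k"
    have "Sq 1 \<otimes>\<^bsub>\<A>\<^esub> \<eta> \<in> bg_dom (n + 1) k"
      using steenrod_deg_Sq[of 1] \<eta> by (intro bg_dom_mult_left) auto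
    then show "\<alpha> (n + 1) k x (Sq 1 \<otimes>\<^bsub>\<A>\<^esub> \<eta>) = \<alpha> n k \<one>\<^bsub>gr (J n) k\<^esub> \<eta>"
      by (simp only: x bg_composite_zero(1)[OF \<alpha>_closed[OF zw(1)] \<eta>] \<alpha>_one[OF \<eta>])
  next
    fix q \<eta> assume q: "n + 1 = 4 * q" and \<eta>: "\<eta> \<in> bg_dom (2 * q) k"
    have "scriptJ J n = J (2 * q)" using q by (cases rule: scriptJ_cases[of n]) auto
    moreover have "Sq (2 * q) \<otimes>\<^bsub>\<A>\<^esub> \<eta> \<in> bg_dom (n + 1) k"
      using q steenrod_deg_Sq[of "2 * q"] \<eta> by (intro bg_dom_mult_left) auto
    ultimately show "\<alpha> (n + 1) k x (Sq (2 * q) \<otimes>\<^bsub>\<A>\<^esub> \<eta>) = \<alpha> (2 * q) k \<one>\<^bsub>gr (scriptJ J n) k\<^esub> \<eta>"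
      by (simp only: x bg_composite_zero(2)[OF \<alpha>_closed[OF zw(1)] q \<eta>] \<alpha>_one[OF \<eta>])
  qed
  then show ?thesis unfolding p xy by (simp add: bg_sum_def)
qed

text \<open>The first component of the preimage corresponds to the functional given by \<open>bg_exact\<close>. The
  second column of the matrix is zero, so the second component may be the unit.\<close>

lemma bg_map_kernel:
  assumes "p \<in> carrier (gr (bg_sum J (n + 1)) k)" "bg_map J \<rho> n k p = \<one>\<^bsub>gr (bg_sum J n) k\<^esub>"
  shows "p \<in> bg_map J \<rho> (n + 1) k ` carrier (gr (bg_sum J (n + 2)) k)"
proof -
  have n: "n + 1 + 1 = n + 2" by simp
  obtain x y where p: "p = (x, y)" by (cases p)
  have xy: "x \<in> carrier (gr (J (n + 1)) k)" "y \<in> carrier (gr (scriptJ J (n + 1)) k)"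
    using assms(1) by (simp_all add: p bg_sum_def)
  have one: "\<one>\<^bsub>gr M k\<^esub> \<in> carrier (gr M k)" if "unstable M" for M :: "'a gmodule"
    using monoid.one_closed[OF group.is_monoid[OF unstable_grp[OF that]]] .
  have zero: "bg_map J \<rho> n k (x, y) = (\<one>\<^bsub>gr (J n) k\<^esub>, \<one>\<^bsub>gr (scriptJ J n) k\<^esub>)"
    using assms(2) by (simp add: p bg_sum_def)
  note zero = zero[unfolded bg_map_eq_iff[OF xy one[OF J_unstable] one[OF scriptJ_unstable]]]
  \<comment> \<open>If \<open>n + 2\<close> is not divisible by 4, then \<open>y\<close> lies in the zero module, and \<open>\<chi>\<close> is never evaluated.\<close>
  define \<chi> where "\<chi> = \<alpha> (2 * ((n + 2) div 4)) k y"
  have \<chi>: "\<chi> \<in> bg_carrier (2 * q) k" if q: "n + 2 = 4 * q" for q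
  proof -
    have "scriptJ J (n + 1) = J (2 * q)" using q by (cases rule: scriptJ_cases[of "n + 1"]) auto
    moreover have "(n + 2) div 4 = q" using q by simp
    ultimately show ?thesis using \<alpha>_closed[of y "2 * q" k] xy(2) by (simp only: \<chi>_def)
  qed
  have z1: "\<alpha> (n + 1) k x (Sq 1 \<otimes>\<^bsub>\<A>\<^esub> \<eta>) = 0" if "\<eta> \<in> bg_dom n k" for \<eta>
    using zero that \<alpha>_one by simp
  have z2: "\<alpha> (n + 1) k x (Sq (2 * q) \<otimes>\<^bsub>\<A>\<^esub> \<eta>) = 0" if q: "n + 1 = 4 * q" and \<eta>: "\<eta> \<in> bg_dom (2 * q) k" for q \<eta>
  proof -
    have "scriptJ J n = J (2 * q)" using q by (cases rule: scriptJ_cases[of n]) auto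
    then show ?thesis using zero q \<eta> \<alpha>_one[OF \<eta>] by simp
  qed
  obtain \<psi> where \<psi>: "\<psi> \<in> bg_carrier (n + 2) k"
    "\<forall>\<eta>\<in>bg_dom (n + 1) k. \<psi> (Sq 1 \<otimes>\<^bsub>\<A>\<^esub> \<eta>) = \<alpha> (n + 1) k x \<eta>"
    "\<forall>q. n + 2 = 4 * q \<longrightarrow> (\<forall>\<eta>\<in>bg_dom (2 * q) k. \<psi> (Sq (2 * q) \<otimes>\<^bsub>\<A>\<^esub> \<eta>) = \<chi> \<eta>)"
    using bg_exact[OF \<alpha>_closed[OF xy(1)] \<chi> z1 z2] by blast
  obtain z where z: "z \<in> carrier (gr (J (n + 2)) k)" "\<alpha> (n + 2) k z = \<psi>"
  proof -
    have "\<psi> \<in> \<alpha> (n + 2) k ` carrier (gr (J (n + 2)) k)"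
      unfolding bij_betw_imp_surj_on[OF \<alpha>_bij[of "n + 2" k]] by (rule \<psi>(1))
    then show ?thesis by (elim imageE) (rule that, simp_all)
  qed
  let ?w = "\<one>\<^bsub>gr (scriptJ J (n + 2)) k\<^esub>"
  have w: "?w \<in> carrier (gr (scriptJ J (n + 2)) k)" by (rule one[OF scriptJ_unstable])
  have "bg_map J \<rho> (n + 1) k (z, ?w) = (x, y)"
    unfolding bg_map_eq_iff[of z "n + 1" k ?w x y, unfolded n, OF z(1) w xy] z(2)
  proof (intro conjI allI impI \<psi>(2))
    fix q assume q: "n + 2 = 4 * q"
    then have "(n + 2) div 4 = q" by simp
    then have "\<chi> = \<alpha> (2 * q) k y" by (simp only: \<chi>_def)
    with \<psi>(3) q show "\<forall>\<eta>\<in>bg_dom (2 * q) k. \<psi> (Sq (2 * q) \<otimes>\<^bsub>\<A>\<^esub> \<eta>) = \<alpha> (2 * q) k y \<eta>" by blast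
  qed
  moreover have "(z, ?w) \<in> carrier (gr (bg_sum J (n + 2)) k)" using z(1) w by (simp add: bg_sum_def)
  ultimately show ?thesis unfolding p by (metis imageI)
qed

lemma bg_exact_at:
  "exact_at (bg_sum J (n + 2)) (bg_sum J (n + 1)) (bg_sum J n) (bg_map J \<rho> (n + 1)) (bg_map J \<rho> n)"
proof -
  have f: "bg_map J \<rho> (n + 1) \<in> Mor (bg_sum J (n + 2)) (bg_sum J (n + 1))"
    using bg_map_Mor[of "n + 1"] by simp
  note g = bg_map_Mor[of n]
  have "exact_seq ([gr (bg_sum J n) k, gr (bg_sum J (n + 1)) k, gr (bg_sum J (n + 2)) k],
      [bg_map J \<rho> n k, bg_map J \<rho> (n + 1) k])" for k
  proof (rule exact_seq.extension[OF exact_seq.unity])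
    show "group_hom (gr (bg_sum J (n + 2)) k) (gr (bg_sum J (n + 1)) k) (bg_map J \<rho> (n + 1) k)"
      using unstable_grp[OF bg_sum_unstable] Mor_hom[OF f] by (simp add: group_hom_def group_hom_axioms_def)
    show "kernel (gr (bg_sum J (n + 1)) k) (gr (bg_sum J n) k) (bg_map J \<rho> n k)
        = bg_map J \<rho> (n + 1) k ` carrier (gr (bg_sum J (n + 2)) k)"
      using bg_map_kernel bg_map_bg_map Mor_closed[OF f] by (auto simp: kernel_def)
  qed (rule unstable_grp[OF bg_sum_unstable] Mor_hom[OF g])+
  then show ?thesis
    unfolding exact_at_def using bg_sum_unstable f g by blast
qed

end

theorem proposition2p6:
  fixes J :: "nat \<Rightarrow> 'a gmodule"
    and \<rho> :: "nat \<Rightarrow> 'a gmodule \<Rightarrow> (nat \<Rightarrow> 'a \<Rightarrow> 'a) \<Rightarrow> 'a \<Rightarrow> bit"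
    and n :: nat
  assumes "infinite (UNIV :: 'a set)"
    and "\<And>m. represents m (J m) (\<rho> m)"
    and "n \<ge> 1"
  shows "exact_at (bg_sum J (n + 2)) (bg_sum J (n + 1)) (bg_sum J n) (bg_map J \<rho> (n + 1)) (bg_map J \<rho> n)"
proof -
  have "\<forall>p. \<exists>\<alpha>. realizes p (J p) (universal (\<rho> p) (J p)) \<alpha>"
    using represents_realizes[OF assms(1,2)] by metis
  then obtain \<alpha> where "\<And>p. realizes p (J p) (universal (\<rho> p) (J p)) (\<alpha> p)" by metis
  then interpret realized_family J \<rho> \<alpha> by unfold_locales (rule assms(2))
  show ?thesis by (rule bg_exact_at)
qed

end
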